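(* Let $G$ be a hairball whose unique cycle $C_G$ has an odd number of vertices, suppose $G$ is in simplest form and $G$ is not just a cycle, and let $v(G)$ be its number of vertices. Then the nim-value $g(G)$ in graph chomp is determined as follows: (1) If $v(G)$ is even and $G$ is obtained from $C_G$ by attaching, at a single vertex $A$ of $C_G$, a path with $k$ vertices and a path with $k+1$ vertices for some integer $k\ge 0$ (each path joined to $A$ by one edge from one of its endpoints; for $k=0$ only a single pendant vertex is attached to $A$), all other vertices of $C_G$ having degree $2$, then $g(G)=4$. (2) If $v(G)$ is even and $G$ is not of the form in (1), then $g(G)=0$. (3) If $v(G)$ is odd, then $g(G)=3$.
   Context: A pseudotree is a finite connected simple graph containing exactly one cycle, denoted $C_G$. A hairball is a pseudotree in which every vertex not on $C_G$ has degree at most $2$. Graph chomp is played on a finite simple graph: two players alternate, and a move consists either of deleting one edge, or of deleting one vertex together with all edges incident to it. The player who makes the last move wins. The nim-value $g$ of a position is defined recursively: the empty graph has nim-value $0$, and $g(G)$ is the minimal nonnegative integer not equal to the nim-value of any position reachable from $G$ in one move. An involution of a graph $G$ is a permutation $\tau$ of its vertices with $\tau^2=\mathrm{id}$ such that $\{x,y\}$ is an edge iff $\{\tau(x),\tau(y)\}$ is an edge. $G$ is in simplest form if there is no involution $\tau\neq\mathrm{id}$ of $G$ such that no edge has its two endpoints interchanged by $\tau$ (i.e. whose fixed set of vertices and edges is a simplicial complex). *)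

theory Defs
  imports Main "HOL-Combinatorics.Permutations"
begin

datatype 'a graph = Graph (verts: "'a set") (edges: "'a set set")

definition finite_simple_graph :: "'a graph \<Rightarrow> bool" where
  "finite_simple_graph G \<longleftrightarrow>
     finite (verts G) \<and> (\<forall>e \<in> edges G. e \<subseteq> verts G \<and> card e = 2)"

definition subgraph :: "'a graph \<Rightarrow> 'a graph \<Rightarrow> bool" where
  "subgraph H G \<longleftrightarrow> verts H \<subseteq> verts G \<and> edges H \<subseteq> edges G"

definition degree :: "'a graph \<Rightarrow> 'a \<Rightarrow> nat" where
  "degree G v = card {e \<in> edges G. v \<in> e}"

definition connected_graph :: "'a graph \<Rightarrow> bool" where
  "connected_graph G \<longleftrightarrow>
     verts G \<noteq> {} \<and>
     (\<forall>x \<in> verts G. \<forall>y \<in> verts G. (x, y) \<in> {(u, v). {u, v} \<in> edges G}\<^sup>*)"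

definition cycle_graph :: "'a list \<Rightarrow> 'a graph" where
  "cycle_graph xs =
     Graph (set xs) {{xs ! i, xs ! (Suc i mod length xs)} |i. i < length xs}"

text \<open>Cycles are counted as subgraphs, so that the choice of a starting vertex and of a
  direction of traversal does not matter.\<close>

definition cycles :: "'a graph \<Rightarrow> 'a graph set" where
  "cycles G = {C. subgraph C G \<and> (\<exists>xs. distinct xs \<and> 3 \<le> length xs \<and> C = cycle_graph xs)}"

definition pseudotree :: "'a graph \<Rightarrow> bool" where
  "pseudotree G \<longleftrightarrow>
     finite_simple_graph G \<and> connected_graph G \<and> (\<exists>!C. C \<in> cycles G)"

definition cycle_of :: "'a graph \<Rightarrow> 'a graph" where
  "cycle_of G = (THE C. C \<in> cycles G)"

definition hairball :: "'a graph \<Rightarrow> bool" where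
  "hairball G \<longleftrightarrow>
     pseudotree G \<and> (\<forall>v \<in> verts G - verts (cycle_of G). degree G v \<le> 2)"

definition delete_edge :: "'a graph \<Rightarrow> 'a set \<Rightarrow> 'a graph" where
  "delete_edge G e = Graph (verts G) (edges G - {e})"

definition delete_vertex :: "'a graph \<Rightarrow> 'a \<Rightarrow> 'a graph" where
  "delete_vertex G v = Graph (verts G - {v}) {e \<in> edges G. v \<notin> e}"

definition moves :: "'a graph \<Rightarrow> 'a graph set" where
  "moves G = delete_edge G ` edges G \<union> delete_vertex G ` verts G"

definition mex :: "nat set \<Rightarrow> nat" where
  "mex S = (LEAST n. n \<notin> S)"

lemma finite_edges: "finite_simple_graph G \<Longrightarrow> finite (edges G)"
  unfolding finite_simple_graph_def
  by (rule finite_subset[of _ "Pow (verts G)"]) auto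

lemma finite_moves: "finite_simple_graph G \<Longrightarrow> finite (moves G)"
  by (simp add: moves_def finite_edges) (simp add: finite_simple_graph_def)

lemma finite_simple_graph_moves:
  "finite_simple_graph G \<Longrightarrow> H \<in> moves G \<Longrightarrow> finite_simple_graph H"
  unfolding moves_def finite_simple_graph_def delete_edge_def delete_vertex_def
  by (elim UnE imageE conjE; simp; blast)

lemma card_moves_less:
  assumes "finite_simple_graph G" and "H \<in> moves G"
  shows "card (verts H) + card (edges H) < card (verts G) + card (edges G)"
proof -
  have fV: "finite (verts G)" and fE: "finite (edges G)"
    using assms(1) by (auto simp: finite_simple_graph_def finite_edges)
  from assms(2) consider e where "e \<in> edges G" "H = delete_edge G e"
    | v where "v \<in> verts G" "H = delete_vertex G v"
    by (auto simp: moves_def)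
  then show ?thesis
  proof cases
    case 1
    then show ?thesis
      using card_Diff1_less[OF fE, of e] by (simp add: delete_edge_def)
  next
    case 2
    have "card {e \<in> edges G. v \<notin> e} \<le> card (edges G)"
      using fE by (intro card_mono) auto
    with 2 show ?thesis
      using card_Diff1_less[OF fV, of v] by (simp add: delete_vertex_def)
  qed
qed

text \<open>The value outside the finite simple graphs is a dummy; all positions reachable from a
  finite simple graph are finite simple graphs.\<close>

function nim_value :: "'a graph \<Rightarrow> nat" where
  "nim_value G = (if finite_simple_graph G then mex (nim_value ` moves G) else 0)"
  by auto
termination
  by (relation "measure (\<lambda>G. card (verts G) + card (edges G))") (auto simp: card_moves_less)

declare nim_value.simps [simp del]

definition involution :: "'a graph \<Rightarrow> ('a \<Rightarrow> 'a) \<Rightarrow> bool" where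
  "involution G \<tau> \<longleftrightarrow>
     \<tau> permutes verts G \<and> \<tau> \<circ> \<tau> = id \<and>
     (\<forall>x \<in> verts G. \<forall>y \<in> verts G. {x, y} \<in> edges G \<longleftrightarrow> {\<tau> x, \<tau> y} \<in> edges G)"

definition simplest_form :: "'a graph \<Rightarrow> bool" where
  "simplest_form G \<longleftrightarrow>
     \<not> (\<exists>\<tau>. involution G \<tau> \<and> \<tau> \<noteq> id \<and>
          (\<forall>x y. {x, y} \<in> edges G \<longrightarrow> \<not> (\<tau> x = y \<and> \<tau> y = x)))"

definition path_edges :: "'a list \<Rightarrow> 'a set set" where
  "path_edges xs = {{xs ! i, xs ! Suc i} |i. Suc i < length xs}"

text \<open>The paths are \<open>ps\<close> and \<open>qs\<close>, each attached to \<open>A\<close> by its first vertex;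
  \<open>ps\<close> is empty and contributes no edge if \<open>k = 0\<close>.  That the other vertices of the cycle have
  degree 2 follows from the equation for the edge set.\<close>

definition two_consecutive_hairs :: "'a graph \<Rightarrow> bool" where
  "two_consecutive_hairs G \<longleftrightarrow>
     (\<exists>A k ps qs. A \<in> verts (cycle_of G) \<and>
        length ps = k \<and> length qs = k + 1 \<and> distinct (ps @ qs) \<and>
        set (ps @ qs) \<inter> verts (cycle_of G) = {} \<and>
        verts G = verts (cycle_of G) \<union> set ps \<union> set qs \<and>
        edges G = edges (cycle_of G) \<union> path_edges (A # ps) \<union> path_edges (A # qs))"

end

theory Submission
  imports Defs
begin

text \<open>A bipartite graph has value \<open>(v mod 2) + 2 (e mod 2)\<close>, a disjoint union has the nim sum
  of the values, and a graph has the value of the fixed subgraph of any simplicial involution.  The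
  last fact lets pairs of equally long hairs at one vertex cancel, so the value of an odd cycle with
  hairs depends only on the set of pairs \<open>(A, l)\<close> for which the number of hairs of length \<open>l\<close> at
  \<open>A\<close> is odd.  A move on the cycle leaves a bipartite graph, and a move on a hair shortens it from
  \<open>l\<close> to \<open>j\<close> and splits off a path with \<open>l - j\<close> or \<open>l - j - 1\<close> vertices.  By induction all
  values of moves can be read off this set, and the theorem becomes a parity argument.\<close>

text \<open>Shortening a hair can produce two equal hairs at one vertex, so simplest form is not
  preserved by moves and cannot be carried through an induction. The value is therefore computed for
  every system of hairs, on every core that shares the relevant parities of an odd cycle; simplest
  form enters only at the end, to read the hairs off their type. Since the core has an odd number of
  vertices, v(G) is even exactly when the total hair length is odd. In that case a move of value 0
  has to lead to the type of a bare core: the last vertex of a hair of length k + 1 is deleted, and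
  the hair of length k that remains is empty or cancels against another one. Only the type of two
  consecutive hairs allows this, which is why it alone escapes the value 0; its moves then reach 0,
  1, 2, 3 and miss 4. If the total length is even and the type is not empty, parity keeps 3 out of
  reach while 0, 1 and 2 are reached.\<close>

subsection \<open>Nim values of disjoint unions\<close>

lemma mex_eqI:
  assumes "n \<notin> S" and "\<And>m. m < n \<Longrightarrow> m \<in> S"
  shows "mex S = n"
  unfolding mex_def using assms by (intro Least_equality) (auto simp: not_less[symmetric])

lemma mex_notin: "finite S \<Longrightarrow> mex S \<notin> S"
  unfolding mex_def using ex_new_if_finite[of S] by (metis LeastI infinite_UNIV_nat)

lemma less_mex: "m < mex S \<Longrightarrow> m \<in> S"
  unfolding mex_def using not_less_Least by blast

lemma nim_value_mex:
  "finite_simple_graph G \<Longrightarrow> nim_value G = mex (nim_value ` moves G)"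
  by (subst nim_value.simps) simp

lemma nim_value_neq_move:
  assumes "finite_simple_graph G" "H \<in> moves G"
  shows "nim_value H \<noteq> nim_value G"
  using mex_notin[of "nim_value ` moves G"] assms
  by (metis finite_imageI finite_moves imageI nim_value_mex)

lemma less_nim_value_move:
  assumes "finite_simple_graph G" "m < nim_value G"
  obtains H where "H \<in> moves G" "nim_value H = m"
  using less_mex[of m "nim_value ` moves G"] assms by (auto simp: nim_value_mex)

lemma nim_value_eqI:
  assumes "finite_simple_graph G"
    and "\<And>H. H \<in> moves G \<Longrightarrow> nim_value H \<noteq> n"
    and "\<And>m. m < n \<Longrightarrow> \<exists>H \<in> moves G. nim_value H = m"
  shows "nim_value G = n"
  unfolding nim_value_mex[OF assms(1)] using assms(2,3) by (intro mex_eqI) blast+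

lemma delete_edge_in_moves: "e \<in> edges G \<Longrightarrow> delete_edge G e \<in> moves G"
  and delete_vertex_in_moves: "v \<in> verts G \<Longrightarrow> delete_vertex G v \<in> moves G"
  by (auto simp: moves_def)

section \<open>Arithmetic of the nim sum\<close>

lemma xor_cancel [simp]:
  fixes p q :: nat
  shows "xor (xor p q) q = p" "xor p (xor p q) = q"
    "xor p q = xor p r \<longleftrightarrow> q = r" "xor p q = xor r q \<longleftrightarrow> p = r"
proof -
  show 1: "xor (xor p q) q = p" for p q :: nat
    by (simp add: xor.assoc)
  show 2: "xor p (xor p q) = q" for p q :: nat
    by (simp add: xor.assoc[symmetric])
  show "xor p q = xor p r \<longleftrightarrow> q = r" by (metis 2)
  show "xor p q = xor r q \<longleftrightarrow> p = r" by (metis 1)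
qed

text \<open>The arithmetic behind the sum of two games: a number below a nim sum is obtained by
  lowering one summand. Numbers are compared by halves first and by last bits second. If the halves
  differ, the claim recurses; otherwise the last bit of the nim sum is 1, and the summand that
  carries it can be lowered by clearing that bit.\<close>

lemma xor_less_cases:
  fixes a x y :: nat
  assumes "a < xor x y"
  shows "xor a y < x \<or> xor x a < y"
  using assms
proof (induction x arbitrary: a y rule: less_induct)
  case (less x)
  have split: "m < n \<longleftrightarrow> m div 2 < n div 2 \<or> (m div 2 = n div 2 \<and> m mod 2 < n mod 2)" for m n :: nat
    using div_mult_mod_eq[of m 2] div_mult_mod_eq[of n 2]
      mod_less_divisor[of 2 m] mod_less_divisor[of 2 n] by linarith
  have d: "xor m n div 2 = xor (m div 2) (n div 2)" for m n :: nat
    using drop_bit_xor[of 1 m n] by (simp add: drop_bit_eq_div)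
  have m: "xor m n mod 2 = (if odd m \<noteq> odd n then 1 else 0)" for m n :: nat
    by (simp add: mod_2_eq_odd even_xor_iff)
  consider (lt) "a div 2 < xor (x div 2) (y div 2)"
    | (eq) "a div 2 = xor (x div 2) (y div 2)" "a mod 2 < xor x y mod 2"
    using less.prems unfolding split[of a] d by blast
  then show ?case
  proof cases
    case lt
    show ?thesis
    \<comment> \<open>Halving does not decrease 0, so this case cannot be passed to the induction
      hypothesis.\<close>
    proof (cases "x = 0")
      case True
      then show ?thesis using less.prems by simp
    next
      case False
      then have "xor (a div 2) (y div 2) < x div 2 \<or> xor (x div 2) (a div 2) < y div 2"
        using less.IH[OF _ lt] by simp
      then show ?thesis unfolding split[of "xor a y"] split[of "xor x a"] d by blast
    qed
  next
    case eq
    then have "even a" "odd x \<noteq> odd y"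
      unfolding m by (auto simp: mod_2_eq_odd split: if_splits)
    then show ?thesis
      unfolding split[of "xor a y"] split[of "xor x a"] d m eq(1) xor_cancel
      by (auto simp: mod_2_eq_odd)
  qed
qed

section \<open>Sums of positions\<close>

definition disjoint_union :: "'a graph \<Rightarrow> 'a graph \<Rightarrow> 'a graph" where
  "disjoint_union G H = Graph (verts G \<union> verts H) (edges G \<union> edges H)"

lemma verts_disjoint_union: "verts (disjoint_union G H) = verts G \<union> verts H"
  and edges_disjoint_union: "edges (disjoint_union G H) = edges G \<union> edges H"
  by (simp_all add: disjoint_union_def)

lemma finite_simple_disjoint_union:
  "finite_simple_graph G \<Longrightarrow> finite_simple_graph H \<Longrightarrow>
    finite_simple_graph (disjoint_union G H)"
  by (auto simp: finite_simple_graph_def disjoint_union_def)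

lemma edge_subset_verts: "finite_simple_graph G \<Longrightarrow> e \<in> edges G \<Longrightarrow> e \<subseteq> verts G"
  by (simp add: finite_simple_graph_def)

lemma edge_nonempty: "finite_simple_graph G \<Longrightarrow> e \<in> edges G \<Longrightarrow> e \<noteq> {}"
  by (auto simp: finite_simple_graph_def)

lemma verts_move_subset: "H \<in> moves G \<Longrightarrow> verts H \<subseteq> verts G"
  by (auto simp: moves_def delete_edge_def delete_vertex_def)

lemma moves_disjoint_union:
  assumes "finite_simple_graph G" "finite_simple_graph H" "verts G \<inter> verts H = {}"
  shows "moves (disjoint_union G H) =
    (\<lambda>G'. disjoint_union G' H) ` moves G \<union> disjoint_union G ` moves H"
proof -
  \<comment> \<open>Edges are nonempty, so graphs without a common vertex have no common edge, and
    deleting an edge affects one summand only.\<close>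
  have disj: "e \<notin> edges H" if "e \<in> edges G" for e
    using that assms edge_subset_verts edge_nonempty by (metis Int_greatest subset_empty)
  have disj': "e \<notin> edges G" if "e \<in> edges H" for e
    using that disj by blast
  have "delete_edge (disjoint_union G H) e = disjoint_union (delete_edge G e) H"
    if "e \<in> edges G" for e
    using disj[OF that] by (auto simp: delete_edge_def disjoint_union_def)
  moreover have "delete_edge (disjoint_union G H) e = disjoint_union G (delete_edge H e)"
    if "e \<in> edges H" for e
    using disj'[OF that] by (auto simp: delete_edge_def disjoint_union_def)
  moreover have "delete_vertex (disjoint_union G H) v = disjoint_union (delete_vertex G v) H"
    if "v \<in> verts G" for v
    using that assms(3) edge_subset_verts[OF assms(2)]
    by (auto simp: delete_vertex_def disjoint_union_def)
  moreover have "delete_vertex (disjoint_union G H) v = disjoint_union G (delete_vertex H v)"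
    if "v \<in> verts H" for v
    using that assms(3) edge_subset_verts[OF assms(1)]
    by (auto simp: delete_vertex_def disjoint_union_def)
  ultimately show ?thesis
    unfolding moves_def image_Un image_image
    by (simp add: verts_disjoint_union edges_disjoint_union image_Un Un_ac cong: image_cong)
qed

text \<open>The Sprague-Grundy rule for two summands. A move changes the nim sum because xor is
  injective in each argument; a smaller value is reached by moving in the summand that
  \<open>xor_less_cases\<close> tells to lower.\<close>

theorem nim_value_disjoint_union:
  assumes "finite_simple_graph G" "finite_simple_graph H" "verts G \<inter> verts H = {}"
  shows "nim_value (disjoint_union G H) = xor (nim_value G) (nim_value H)"
  using assms
proof (induction "card (verts G) + card (edges G) + (card (verts H) + card (edges H))"
    arbitrary: G H rule: less_induct)
  case less
  note fin = less.prems(1,2)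
  have left: "nim_value (disjoint_union G' H) = xor (nim_value G') (nim_value H)"
    if "G' \<in> moves G" for G'
    using that less.prems card_moves_less[OF fin(1) that] verts_move_subset[OF that]
    by (intro less.hyps) (auto intro: finite_simple_graph_moves)
  have right: "nim_value (disjoint_union G H') = xor (nim_value G) (nim_value H')"
    if "H' \<in> moves H" for H'
    using that less.prems card_moves_less[OF fin(2) that] verts_move_subset[OF that]
    by (intro less.hyps) (auto intro: finite_simple_graph_moves)
  note mv = moves_disjoint_union[OF less.prems]
  show ?case
  proof (rule nim_value_eqI[OF finite_simple_disjoint_union[OF fin]])
    fix K assume "K \<in> moves (disjoint_union G H)"
    then consider G' where "G' \<in> moves G" "K = disjoint_union G' H"
      | H' where "H' \<in> moves H" "K = disjoint_union G H'"
      unfolding mv by blast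
    then show "nim_value K \<noteq> xor (nim_value G) (nim_value H)"
      using left right nim_value_neq_move[OF fin(1)] nim_value_neq_move[OF fin(2)] by cases auto
  next
    fix m assume "m < xor (nim_value G) (nim_value H)"
    from xor_less_cases[OF this] show "\<exists>K\<in>moves (disjoint_union G H). nim_value K = m"
    proof
      assume "xor m (nim_value H) < nim_value G"
      then obtain G' where "G' \<in> moves G" "nim_value G' = xor m (nim_value H)"
        using less_nim_value_move[OF fin(1)] by blast
      then show ?thesis
        unfolding mv using left[of G'] by auto
    next
      assume "xor (nim_value G) m < nim_value H"
      then obtain H' where "H' \<in> moves H" "nim_value H' = xor (nim_value G) m"
        using less_nim_value_move[OF fin(2)] by blast
      then show ?thesis
        unfolding mv using right[of H'] by auto
    qed
  qed
qed

subsection \<open>Bipartite graphs\<close>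

text \<open>Only one colour class \<open>L\<close> is recorded, and it may contain points outside
  the graph, so the same \<open>L\<close> serves every subgraph.\<close>

definition bipartite :: "'a graph \<Rightarrow> bool" where
  "bipartite G \<longleftrightarrow> (\<exists>L. \<forall>e \<in> edges G. card (e \<inter> L) = 1)"

lemma bipartite_subgraph: "bipartite G \<Longrightarrow> edges H \<subseteq> edges G \<Longrightarrow> bipartite H"
  by (auto simp: bipartite_def)

text \<open>Both sides count the incidences between \<open>L\<close> and the edges. With all
  vertices for \<open>L\<close> this is the handshake lemma; with a colour class of a bipartite
  graph every edge is counted once.\<close>

lemma sum_degree:
  assumes "finite_simple_graph G" "finite L"
  shows "(\<Sum>v\<in>L. degree G v) = (\<Sum>e\<in>edges G. card (e \<inter> L))"
proof -
  have fE: "finite (edges G)" by (rule finite_edges[OF assms(1)])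
  have "(\<Sum>v\<in>L. degree G v) = (\<Sum>v\<in>L. \<Sum>e\<in>edges G. if v \<in> e then 1 else 0)"
    using fE by (simp add: degree_def sum.If_cases Int_def)
  also have "\<dots> = (\<Sum>e\<in>edges G. \<Sum>v\<in>L. if v \<in> e then 1 else 0)"
    by (rule sum.swap)
  also have "\<dots> = (\<Sum>e\<in>edges G. card (e \<inter> L))"
    using assms(2) by (intro sum.cong refl) (simp add: sum.If_cases Int_def conj_commute)
  finally show ?thesis .
qed

lemma even_degree_vertex:
  assumes "finite_simple_graph G" "odd (card (verts G))"
  obtains v where "v \<in> verts G" "even (degree G v)"
proof -
  have fV: "finite (verts G)" using assms(1) by (simp add: finite_simple_graph_def)
  have "(\<Sum>v\<in>verts G. degree G v) = (\<Sum>e\<in>edges G. 2)"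
    unfolding sum_degree[OF assms(1) fV]
    using assms(1) by (intro sum.cong refl) (auto simp: finite_simple_graph_def Int_absorb2)
  then have "even (\<Sum>v\<in>verts G. degree G v)" by simp
  moreover have "odd (\<Sum>v\<in>verts G. degree G v)" if "\<forall>v\<in>verts G. odd (degree G v)"
    using that assms(2) fV by (simp add: even_sum_iff)
      (metis (mono_tags, lifting) Collect_cong Collect_mem_eq)
  ultimately show ?thesis using that by blast
qed

lemma bipartite_odd_degree_vertex:
  assumes "finite_simple_graph G" "bipartite G" "odd (card (edges G))"
  obtains v where "v \<in> verts G" "odd (degree G v)"
proof -
  obtain L where L: "\<forall>e \<in> edges G. card (e \<inter> L) = 1"
    using assms(2) by (auto simp: bipartite_def)
  have fin: "finite (verts G \<inter> L)" using assms(1) by (simp add: finite_simple_graph_def)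
  have "(\<Sum>v\<in>verts G \<inter> L. degree G v) = (\<Sum>e\<in>edges G. 1)"
    unfolding sum_degree[OF assms(1) fin]
  proof (intro sum.cong refl)
    fix e assume e: "e \<in> edges G"
    then have "e \<inter> (verts G \<inter> L) = e \<inter> L"
      using edge_subset_verts[OF assms(1)] by blast
    with L e show "card (e \<inter> (verts G \<inter> L)) = 1" by simp
  qed
  then have "odd (\<Sum>v\<in>verts G \<inter> L. degree G v)" using assms(3) by simp
  then show ?thesis using that by (metis IntD1 dvd_sum)
qed

lemma card_edges_delete_edge:
  assumes "finite_simple_graph G" "e \<in> edges G"
  shows "card (edges G) = Suc (card (edges (delete_edge G e)))"
  using card.remove[OF finite_edges[OF assms(1)] assms(2)] by (simp add: delete_edge_def)

lemma card_verts_delete_vertex: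
  assumes "finite_simple_graph G" "v \<in> verts G"
  shows "card (verts G) = Suc (card (verts (delete_vertex G v)))"
  using card.remove[OF _ assms(2)] assms(1)
  by (simp add: delete_vertex_def finite_simple_graph_def)

lemma card_edges_delete_vertex:
  assumes "finite_simple_graph G"
  shows "card (edges (delete_vertex G v)) + degree G v = card (edges G)"
proof -
  have "card (edges G) = card ({e \<in> edges G. v \<notin> e} \<union> {e \<in> edges G. v \<in> e})"
    by (rule arg_cong[where f = card]) blast
  also have "\<dots> = card {e \<in> edges G. v \<notin> e} + card {e \<in> edges G. v \<in> e}"
    using finite_edges[OF assms] by (intro card_Un_disjoint) auto
  finally show ?thesis by (simp add: delete_vertex_def degree_def)
qed

text \<open>Deleting an edge changes the parity of the number of edges, deleting a vertex that of
  the number of vertices, so no move keeps both parities. The smaller values are reached because the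
  two counting arguments above supply vertices of even and of odd degree where they are
  wanted.\<close>

theorem nim_value_bipartite:
  assumes "finite_simple_graph G" "bipartite G"
  shows "nim_value G = of_bool (odd (card (verts G))) + 2 * of_bool (odd (card (edges G)))"
  using assms
proof (induction "card (verts G) + card (edges G)" arbitrary: G rule: less_induct)
  case less
  note fin = less.prems(1)
  have IH: "nim_value H = of_bool (odd (card (verts H))) + 2 * of_bool (odd (card (edges H)))" if "H \<in> moves G" for H
    using card_moves_less[OF fin that] finite_simple_graph_moves[OF fin that]
      bipartite_subgraph[OF less.prems(2)] that
    by (intro less.hyps) (auto simp: moves_def delete_edge_def delete_vertex_def)
  have edge: "nim_value (delete_edge G e) = of_bool (odd (card (verts G))) + 2 * of_bool (even (card (edges G)))"
    if "e \<in> edges G" for e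
    using IH[OF delete_edge_in_moves[OF that]] card_edges_delete_edge[OF fin that]
    by (simp add: delete_edge_def)
  have vertex: "nim_value (delete_vertex G v) =
      of_bool (even (card (verts G))) + 2 * of_bool (odd (card (edges G) + degree G v))"
    if "v \<in> verts G" for v
    using IH[OF delete_vertex_in_moves[OF that]] card_verts_delete_vertex[OF fin that]
      card_edges_delete_vertex[OF fin, of v, symmetric]
    by simp
  show ?case
  proof (rule nim_value_eqI[OF fin])
    fix H assume "H \<in> moves G"
    then consider e where "e \<in> edges G" "H = delete_edge G e"
      | v where "v \<in> verts G" "H = delete_vertex G v"
      by (auto simp: moves_def)
    then show "nim_value H \<noteq> of_bool (odd (card (verts G))) + 2 * of_bool (odd (card (edges G)))"
    proof cases
      case 1
      then show ?thesis using edge by auto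
    next
      case 2
      then show ?thesis by (auto simp: vertex)
    qed
  next
    fix m :: nat assume m: "m < of_bool (odd (card (verts G))) + 2 * of_bool (odd (card (edges G)))"
    show "\<exists>H\<in>moves G. nim_value H = m"
    proof (cases "odd (card (edges G))")
      case False
      then have "odd (card (verts G))" "m = 0" using m by (auto simp: of_bool_def split: if_splits)
      then obtain v where "v \<in> verts G" "even (degree G v)"
        using even_degree_vertex[OF fin] by blast
      then show ?thesis
        using vertex[of v] False \<open>odd _\<close> \<open>m = 0\<close> delete_vertex_in_moves
        by (intro bexI[of _ "delete_vertex G v"]) auto
    next
      case oE: True
      then obtain e where e: "e \<in> edges G" by (cases "edges G = {}") auto
      obtain v where v: "v \<in> verts G" "odd (degree G v)"
        using bipartite_odd_degree_vertex[OF less.prems oE] by blast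
      show ?thesis
      proof (cases "odd (card (verts G))")
        case True
        obtain u where u: "u \<in> verts G" "even (degree G u)"
          using even_degree_vertex[OF fin True] by blast
        have "m = 0 \<or> m = 1 \<or> m = 2" using m True oE by auto
        moreover have "nim_value (delete_vertex G v) = 0" "nim_value (delete_edge G e) = 1"
          "nim_value (delete_vertex G u) = 2"
          using vertex[OF v(1)] vertex[OF u(1)] edge[OF e] True oE u v by auto
        ultimately show ?thesis
          using delete_vertex_in_moves[OF u(1)] delete_vertex_in_moves[OF v(1)]
            delete_edge_in_moves[OF e] by metis
      next
        case False
        have "m = 0 \<or> m = 1" using m False oE by auto
        moreover have "nim_value (delete_edge G e) = 0" "nim_value (delete_vertex G v) = 1"
          using vertex[OF v(1)] edge[OF e] False oE v by auto
        ultimately show ?thesis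
          using delete_vertex_in_moves[OF v(1)] delete_edge_in_moves[OF e] by metis
      qed
    qed
  qed
qed

subsection \<open>Simplicial involutions\<close>

definition fixed_subgraph :: "'a graph \<Rightarrow> ('a \<Rightarrow> 'a) \<Rightarrow> 'a graph" where
  "fixed_subgraph G \<tau> =
    Graph {v \<in> verts G. \<tau> v = v} {e \<in> edges G. \<forall>v\<in>e. \<tau> v = v}"

text \<open>The last clause excludes flipped edges: an edge mapped to itself is fixed pointwise.
  Invariance of vertices and edges is asked in one direction, since \<tau> is its own inverse on the
  whole type.\<close>

definition simplicial_involution :: "'a graph \<Rightarrow> ('a \<Rightarrow> 'a) \<Rightarrow> bool" where
  "simplicial_involution G \<tau> \<longleftrightarrow> (\<forall>v. \<tau> (\<tau> v) = v) \<and> (\<forall>v\<in>verts G. \<tau> v \<in> verts G) \<and>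
    (\<forall>e\<in>edges G. \<tau> ` e \<in> edges G) \<and>
    (\<forall>e\<in>edges G. \<tau> ` e = e \<longrightarrow> (\<forall>v\<in>e. \<tau> v = v))"

lemma finite_simple_fixed_subgraph:
  "finite_simple_graph G \<Longrightarrow> finite_simple_graph (fixed_subgraph G \<tau>)"
  by (auto simp: finite_simple_graph_def fixed_subgraph_def)

lemma simplicial_involution_subgraph:
  assumes "simplicial_involution G \<tau>" "verts H \<subseteq> verts G" "edges H \<subseteq> edges G"
    and "\<And>v. v \<in> verts H \<Longrightarrow> \<tau> v \<in> verts H"
    and "\<And>e. e \<in> edges H \<Longrightarrow> \<tau> ` e \<in> edges H"
  shows "simplicial_involution H \<tau>"
  unfolding simplicial_involution_def
  using assms(1)[unfolded simplicial_involution_def] assms(3-5)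
  by (intro conjI) (iprover | meson subsetD)+

text \<open>A move off the fixed subgraph can be answered by its mirror image, so by induction its
  result does not have the value of the fixed subgraph; moves in the fixed subgraph keep the
  symmetry.\<close>

theorem nim_value_fixed_subgraph:
  assumes "finite_simple_graph G" "simplicial_involution G \<tau>"
  shows "nim_value G = nim_value (fixed_subgraph G \<tau>)"
  using assms
proof (induction "card (verts G) + card (edges G)" arbitrary: G rule: less_induct)
  case less
  note fin = less.prems(1)
  note finF = finite_simple_fixed_subgraph[OF fin, of \<tau>]
  have inv: "\<tau> (\<tau> v) = v" for v
    using less.prems(2) unfolding simplicial_involution_def by blast
  then have img: "\<tau> ` \<tau> ` e = e" for e by (simp add: image_image)
  have swap: "\<tau> v \<noteq> u" if "v \<noteq> \<tau> u" for u v
    using that inv by metis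
  have swap_edge: "\<tau> ` f \<noteq> e" if "f \<noteq> \<tau> ` e" for e f
    using that img by metis
  have mem_iff: "v \<in> \<tau> ` e \<longleftrightarrow> \<tau> v \<in> e" for v e
    using inv by (metis image_iff)
  have tv: "\<tau> v \<in> verts G" if "v \<in> verts G" for v
    using that less.prems(2) unfolding simplicial_involution_def by blast
  have te: "\<tau> ` e \<in> edges G" "\<tau> ` e = e \<Longrightarrow> v \<in> e \<Longrightarrow> \<tau> v = v" if "e \<in> edges G" for e v
    using that less.prems(2) unfolding simplicial_involution_def by blast+
  \<comment> \<open>Deleting a fixed edge, or below a fixed vertex, commutes with taking the fixed
    subgraph. These moves therefore realise all moves of the fixed subgraph with the same
    values.\<close>
  have fix_edge: "nim_value (delete_edge G e) = nim_value (delete_edge (fixed_subgraph G \<tau>) e)"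
    if e: "e \<in> edges (fixed_subgraph G \<tau>)" for e
  proof -
    have e': "e \<in> edges G" "\<tau> ` e = e" using e by (auto simp: fixed_subgraph_def)
    note mv = delete_edge_in_moves[OF e'(1)]
    have "simplicial_involution (delete_edge G e) \<tau>"
      using tv te(1) swap_edge[of _ e] e'(2)
      by (intro simplicial_involution_subgraph[OF less.prems(2)]) (simp_all add: delete_edge_def subset_iff)
    then have "nim_value (delete_edge G e) = nim_value (fixed_subgraph (delete_edge G e) \<tau>)"
      using less.hyps[OF card_moves_less[OF fin mv] finite_simple_graph_moves[OF fin mv]] by blast
    also have "fixed_subgraph (delete_edge G e) \<tau> = delete_edge (fixed_subgraph G \<tau>) e"
      by (auto simp: fixed_subgraph_def delete_edge_def)
    finally show ?thesis .
  qed
  have fix_vertex: "nim_value (delete_vertex G u) = nim_value (delete_vertex (fixed_subgraph G \<tau>) u)"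
    if u: "u \<in> verts (fixed_subgraph G \<tau>)" for u
  proof -
    have u': "u \<in> verts G" "\<tau> u = u" using u by (auto simp: fixed_subgraph_def)
    note mv = delete_vertex_in_moves[OF u'(1)]
    have "simplicial_involution (delete_vertex G u) \<tau>"
      using tv te(1) swap[of _ u] u'(2)
      by (intro simplicial_involution_subgraph[OF less.prems(2)])
        (simp_all add: delete_vertex_def subset_iff mem_iff)
    then have "nim_value (delete_vertex G u) = nim_value (fixed_subgraph (delete_vertex G u) \<tau>)"
      using less.hyps[OF card_moves_less[OF fin mv] finite_simple_graph_moves[OF fin mv]] by blast
    also have "fixed_subgraph (delete_vertex G u) \<tau> = delete_vertex (fixed_subgraph G \<tau>) u"
      by (auto simp: fixed_subgraph_def delete_vertex_def)
    finally show ?thesis .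
  qed
  have mirror: "nim_value H \<noteq> nim_value (fixed_subgraph G \<tau>)"
    if H: "H \<in> moves G" and K: "K \<in> moves H" "simplicial_involution K \<tau>"
      "fixed_subgraph K \<tau> = fixed_subgraph G \<tau>" for H K
  proof -
    note finH = finite_simple_graph_moves[OF fin H]
    have "nim_value K = nim_value (fixed_subgraph K \<tau>)"
      using card_moves_less[OF fin H] card_moves_less[OF finH K(1)]
        finite_simple_graph_moves[OF finH K(1)] K(2)
      by (intro less.hyps) auto
    then show ?thesis using nim_value_neq_move[OF finH K(1)] K(3) by simp
  qed
  have move_edge: "nim_value (delete_edge G e) \<noteq> nim_value (fixed_subgraph G \<tau>)"
    if e: "e \<in> edges G" "e \<notin> edges (fixed_subgraph G \<tau>)" for e
  proof (rule mirror)
    have ne: "\<tau> ` e \<noteq> e" using e te by (auto simp: fixed_subgraph_def)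
    show "delete_edge G e \<in> moves G" using e(1) by (rule delete_edge_in_moves)
    show "delete_edge (delete_edge G e) (\<tau> ` e) \<in> moves (delete_edge G e)"
      using te(1)[OF e(1)] ne by (intro delete_edge_in_moves) (simp add: delete_edge_def)
    show "simplicial_involution (delete_edge (delete_edge G e) (\<tau> ` e)) \<tau>"
      using tv te(1) swap_edge[of _ e] swap_edge[of _ "\<tau> ` e", unfolded img]
      by (intro simplicial_involution_subgraph[OF less.prems(2)]) (simp_all add: delete_edge_def subset_iff)
    show "fixed_subgraph (delete_edge (delete_edge G e) (\<tau> ` e)) \<tau> = fixed_subgraph G \<tau>"
    proof -
      \<comment> \<open>The two deleted edges are exchanged by \<tau>, so neither belongs to the
        fixed subgraph.\<close>
      have "f \<noteq> e \<and> f \<noteq> \<tau> ` e" if "f \<in> edges (fixed_subgraph G \<tau>)" for f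
      proof -
        have "\<tau> ` f = f" using that by (auto simp: fixed_subgraph_def)
        then show ?thesis using that e(2) img[of e] by metis
      qed
      then show ?thesis unfolding fixed_subgraph_def delete_edge_def by auto
    qed
  qed
  have move_vertex: "nim_value (delete_vertex G u) \<noteq> nim_value (fixed_subgraph G \<tau>)"
    if u: "u \<in> verts G" "u \<notin> verts (fixed_subgraph G \<tau>)" for u
  proof (rule mirror)
    have ne: "\<tau> u \<noteq> u" using u by (auto simp: fixed_subgraph_def)
    show "delete_vertex G u \<in> moves G" using u(1) by (rule delete_vertex_in_moves)
    show "delete_vertex (delete_vertex G u) (\<tau> u) \<in> moves (delete_vertex G u)"
      using tv[OF u(1)] ne by (intro delete_vertex_in_moves) (simp add: delete_vertex_def)
    show "simplicial_involution (delete_vertex (delete_vertex G u) (\<tau> u)) \<tau>"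
      using tv te(1) swap[of _ u] swap[of _ "\<tau> u", unfolded inv]
      by (intro simplicial_involution_subgraph[OF less.prems(2)])
        (simp_all add: delete_vertex_def subset_iff mem_iff inv)
    show "fixed_subgraph (delete_vertex (delete_vertex G u) (\<tau> u)) \<tau> = fixed_subgraph G \<tau>"
    proof -
      have "v \<noteq> u \<and> v \<noteq> \<tau> u" if "\<tau> v = v" for v
        using that ne inv by metis
      then show ?thesis unfolding fixed_subgraph_def delete_vertex_def by auto
    qed
  qed
  show ?case
  proof (rule nim_value_eqI[OF fin])
    fix H assume "H \<in> moves G"
    then consider e where "e \<in> edges G" "H = delete_edge G e"
      | v where "v \<in> verts G" "H = delete_vertex G v"
      by (auto simp: moves_def)
    then show "nim_value H \<noteq> nim_value (fixed_subgraph G \<tau>)"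
    proof cases
      case 1
      then show ?thesis
        using move_edge[OF 1(1)] fix_edge nim_value_neq_move[OF finF delete_edge_in_moves, of e]
        by (cases "e \<in> edges (fixed_subgraph G \<tau>)") auto
    next
      case 2
      then show ?thesis
        using move_vertex[OF 2(1)] fix_vertex nim_value_neq_move[OF finF delete_vertex_in_moves, of v]
        by (cases "v \<in> verts (fixed_subgraph G \<tau>)") auto
    qed
  next
    fix m assume "m < nim_value (fixed_subgraph G \<tau>)"
    then obtain H where H: "H \<in> moves (fixed_subgraph G \<tau>)" "nim_value H = m"
      using less_nim_value_move[OF finF] by blast
    then consider e where "e \<in> edges (fixed_subgraph G \<tau>)" "H = delete_edge (fixed_subgraph G \<tau>) e"
      | v where "v \<in> verts (fixed_subgraph G \<tau>)" "H = delete_vertex (fixed_subgraph G \<tau>) v"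
      by (auto simp: moves_def)
    then show "\<exists>H\<in>moves G. nim_value H = m"
    proof cases
      case 1
      then have "e \<in> edges G" by (simp add: fixed_subgraph_def)
      then show ?thesis
        using 1(2) fix_edge[OF 1(1)] H(2) by (intro bexI[OF _ delete_edge_in_moves]) auto
    next
      case 2
      then have "v \<in> verts G" by (simp add: fixed_subgraph_def)
      then show ?thesis
        using 2(2) fix_vertex[OF 2(1)] H(2) by (intro bexI[OF _ delete_vertex_in_moves]) auto
    qed
  qed
qed

subsection \<open>The game on hair types\<close>

text \<open>A pair \<open>(A, l)\<close> stands for a hair of length \<open>l\<close> at \<open>A\<close>; hairs of length 0 do not count, and
  two equal hairs cancel.\<close>

definition toggle :: "'b \<times> nat \<Rightarrow> ('b \<times> nat) set \<Rightarrow> ('b \<times> nat) set" where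
  "toggle p S = (if snd p = 0 then S else (S - {p}) \<union> ({p} - S))"

text \<open>Used modulo 2, where it agrees with the number of hair vertices, since cancelling pairs
  contribute an even number.\<close>

definition weight :: "('b \<times> nat) set \<Rightarrow> nat" where
  "weight S = (\<Sum>p\<in>S. snd p)"

text \<open>Its parity is what the hairs contribute to the parity of the degree of
  \<open>A\<close>.\<close>

definition hairs_at :: "('b \<times> nat) set \<Rightarrow> 'b \<Rightarrow> nat" where
  "hairs_at S A = card {l. (A, l) \<in> S}"

text \<open>With \<open>toggle\<close> the case \<open>k = 0\<close> yields the single hair of
  length 1 without a separate clause.\<close>

definition consecutive :: "('b \<times> nat) set \<Rightarrow> bool" where
  "consecutive S \<longleftrightarrow> (\<exists>A k. S = toggle (A, k) {(A, Suc k)})"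

text \<open>The empty type is that of a bare odd cycle, of value 0. Even weight means an odd number
  of vertices in the whole graph, odd weight an even number.\<close>

definition type_value :: "('b \<times> nat) set \<Rightarrow> nat" where
  "type_value S =
    (if S = {} then 0 else if even (weight S) then 3 else if consecutive S then 4 else 0)"

text \<open>A nonempty path has one edge less than vertices, so exactly one of the two counts is
  odd. The empty path has no edges, hence the exception at 0.\<close>

definition path_value :: "nat \<Rightarrow> nat" where
  "path_value m = (if m = 0 then 0 else if odd m then 1 else 2)"

text \<open>The three parts are the values after deleting an edge of the core, a vertex of the core, and
  an edge or vertex of a hair of length \<open>l\<close> that leaves a hair of length \<open>j\<close>.\<close>

definition type_moves :: "'b set \<Rightarrow> ('b \<times> nat) set \<Rightarrow> nat set" where
  "type_moves X S =
    {if even (weight S) then 1 else 2} \<union>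
    (\<lambda>A. of_bool (odd (weight S)) + 2 * of_bool (odd (weight S) \<longleftrightarrow> odd (hairs_at S A))) ` X \<union>
    {xor (type_value (toggle (A, j) (toggle (A, l) S))) (path_value d) | A j l d.
      (A, l) \<in> S \<and> j < l \<and> (d = l - j \<or> Suc d = l - j)}"

lemma toggle_0 [simp]: "toggle (A, 0) S = S"
  by (simp add: toggle_def)

lemma toggle_toggle [simp]: "toggle p (toggle p S) = S"
  by (auto simp: toggle_def)

lemma toggle_commute: "toggle p (toggle q S) = toggle q (toggle p S)"
  by (auto simp: toggle_def)

lemma finite_toggle [simp]: "finite (toggle p S) \<longleftrightarrow> finite S"
  by (simp add: toggle_def)

lemma weight_singleton [simp]: "weight {p} = snd p"
  by (simp add: weight_def)

lemma even_weight_toggle: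
  "finite S \<Longrightarrow> even (weight (toggle p S)) \<longleftrightarrow> (even (weight S) \<longleftrightarrow> even (snd p))"
  by (cases "p \<in> S") (auto simp: toggle_def weight_def sum.remove insert_absorb)

lemma even_hairs_at_toggle:
  assumes "finite S"
  shows "even (hairs_at (toggle (B, m) S) A) \<longleftrightarrow> (even (hairs_at S A) \<longleftrightarrow> \<not> (A = B \<and> 0 < m))"
proof (cases "A = B \<and> 0 < m")
  case False
  then have "{l. (A, l) \<in> toggle (B, m) S} = {l. (A, l) \<in> S}" by (auto simp: toggle_def)
  then show ?thesis using False by (simp add: hairs_at_def)
next
  case True
  let ?L = "{l. (A, l) \<in> S}"
  have fin: "finite ?L"
    using finite_imageI[OF assms, of snd] by (rule finite_subset[rotated]) force
  have "{l. (A, l) \<in> toggle (B, m) S} = (?L - {m}) \<union> ({m} - ?L)"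
    using True by (auto simp: toggle_def)
  then have eq: "hairs_at (toggle (B, m) S) A = card ((?L - {m}) \<union> ({m} - ?L))"
    by (simp add: hairs_at_def)
  show ?thesis
  proof (cases "m \<in> ?L")
    case m: True
    then have "hairs_at S A = Suc (hairs_at (toggle (B, m) S) A)"
      unfolding eq using card.remove[OF fin m] by (simp add: hairs_at_def)
    then show ?thesis using True by simp
  next
    case m: False
    then have "hairs_at (toggle (B, m) S) A = Suc (hairs_at S A)"
      unfolding eq using fin by (simp add: hairs_at_def)
    then show ?thesis using True by simp
  qed
qed

lemma type_value_odd: "odd (weight S) \<Longrightarrow> type_value S = (if consecutive S then 4 else 0)"
  by (auto simp: type_value_def weight_def)

lemma type_value_even: "even (weight S) \<Longrightarrow> type_value S = (if S = {} then 0 else 3)"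
  by (auto simp: type_value_def)

lemma path_value_simps [simp]:
  "path_value 0 = 0" "path_value (Suc 0) = 1" "path_value 2 = 2"
  by (simp_all add: path_value_def)

lemma xor_small [simp]:
  "xor (3::nat) (Suc 0) = 2" "xor (3::nat) 2 = 1" "xor (4::nat) (Suc 0) = 5" "xor (4::nat) 2 = 6"
  by (simp_all add: xor_nat_unfold)

text \<open>The parity of \<open>l - j\<close> decides both the parity of the remaining weight and
  which path values can occur. The remaining type then has a value in {0, 3} or in {0, 4}, and a
  short table of nim sums gives all three claims.\<close>

lemma hair_move_value:
  assumes S: "finite S" and lj: "j < l" and d: "d = l - j \<or> Suc d = l - j"
    and x: "x = xor (type_value (toggle (A, j) (toggle (A, l) S))) (path_value d)"
  shows "even (weight S) \<Longrightarrow> x \<noteq> 3"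
    and "odd (weight S) \<Longrightarrow> x \<noteq> 4"
    and "odd (weight S) \<Longrightarrow> x = 0 \<Longrightarrow> toggle (A, j) (toggle (A, l) S) = {} \<and> l = Suc j"
proof -
  let ?T = "toggle (A, j) (toggle (A, l) S)"
  have w: "even (weight ?T) \<longleftrightarrow> (even (weight S) \<longleftrightarrow> even (l - j))"
    using S lj by (auto simp: even_weight_toggle)
  \<comment> \<open>The path value 0 occurs only when nothing is split off, that is, when the end
    vertex of a hair is deleted.\<close>
  have pv: "path_value d \<in> (if even (l - j) then {1, 2} else if l = Suc j then {0, 1} else {1, 2})"
    using d lj by (auto simp: path_value_def split: if_splits)
  note simps = type_value_even type_value_odd x
  show "x \<noteq> 3" if "even (weight S)"
    using w pv that by (cases "even (l - j)") (auto simp: simps split: if_splits)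
  show "x \<noteq> 4" if "odd (weight S)"
    using w pv that by (cases "even (l - j)") (auto simp: simps split: if_splits)
  show "?T = {} \<and> l = Suc j" if "odd (weight S)" "x = 0"
    using w pv that by (cases "even (l - j)") (auto simp: simps split: if_splits)
qed

lemma hair_moveI:
  assumes "(A, l) \<in> S" "j < l" "d = l - j \<or> Suc d = l - j"
    and "x = xor (type_value (toggle (A, j) (toggle (A, l) S))) (path_value d)"
  shows "x \<in> type_moves X S"
  using assms unfolding type_moves_def by blast

lemma vertex_moveI:
  assumes "A \<in> X"
    and "x = of_bool (odd (weight S)) + 2 * of_bool (odd (weight S) \<longleftrightarrow> odd (hairs_at S A))"
  shows "x \<in> type_moves X S"
  using assms unfolding type_moves_def by blast

lemma type_moves_cases:
  assumes "x \<in> type_moves X S"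
  obtains "x = (if even (weight S) then 1 else 2)"
  | A where "A \<in> X"
      "x = of_bool (odd (weight S)) + 2 * of_bool (odd (weight S) \<longleftrightarrow> odd (hairs_at S A))"
  | A j l d where "(A, l) \<in> S" "j < l" "d = l - j \<or> Suc d = l - j"
      "x = xor (type_value (toggle (A, j) (toggle (A, l) S))) (path_value d)"
  using assms unfolding type_moves_def by blast

text \<open>Shortening a hair by 2 keeps the weight even and leaves a type of value 0 or 3;
  splitting off two vertices or one vertex, respectively, makes the nim sum 2. If no hair is that
  long, every hair has length 1 and a vertex carries at most one. An even number of hairs cannot
  meet each of an odd number of core vertices, and deleting a vertex without hairs gives 2.\<close>

lemma two_in_type_moves:
  assumes S: "finite S" "0 \<notin> snd ` S" "fst ` S \<subseteq> X" and X: "finite X" "odd (card X)"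
    and even: "even (weight S)"
  shows "2 \<in> type_moves X S"
proof (cases "\<exists>A l. (A, l) \<in> S \<and> 2 \<le> l")
  case True
  then obtain A l where Al: "(A, l) \<in> S" "2 \<le> l" by blast
  let ?T = "toggle (A, l - 2) (toggle (A, l) S)"
  have "even (weight ?T)" using even S(1) Al by (simp add: even_weight_toggle)
  then have tv: "type_value ?T = (if ?T = {} then 0 else 3)" by (rule type_value_even)
  show ?thesis
  proof (cases "?T = {}")
    case True
    then show ?thesis using Al tv by (intro hair_moveI[of A l S "l - 2" 2]) auto
  next
    case False
    then show ?thesis using Al tv by (intro hair_moveI[of A l S "l - 2" 1]) auto
  qed
next
  case False
  have one: "l = 1" if "(A, l) \<in> S" for A l
  proof -
    have "l \<noteq> 0" using that S(2) by force
    moreover have "\<not> 2 \<le> l" using that False by blast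
    ultimately show ?thesis by simp
  qed
  have "weight S = (\<Sum>p\<in>S. 1)"
    unfolding weight_def using one by (intro sum.cong) auto
  then have "weight S = card S" by simp
  also have "card S = card (fst ` S)"
  proof (rule card_image[symmetric], rule inj_onI)
    fix p q assume "p \<in> S" "q \<in> S" "fst p = fst q"
    moreover have "snd r = 1" if "r \<in> S" for r using one[of "fst r" "snd r"] that by simp
    ultimately show "p = q" by (simp add: prod_eq_iff)
  qed
  finally have "fst ` S \<noteq> X" using even X(2) by (intro notI) simp
  then obtain A where A: "A \<in> X" "A \<notin> fst ` S" using S(3) by blast
  then have "{l. (A, l) \<in> S} = {}" by force
  then have "hairs_at S A = 0" by (simp add: hairs_at_def)
  then show ?thesis using A(1) even by (intro vertex_moveI[of A]) auto
qed

text \<open>If all vertices carry an even number of hairs, shorten the shortest hair at a vertex with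
  hairs by one: no two hairs cancel, and what remains is not a pair of consecutive hairs.\<close>

lemma zero_in_type_moves:
  assumes S: "finite S" "0 \<notin> snd ` S" "fst ` S \<subseteq> X" "S \<noteq> {}"
    and even: "even (weight S)"
  shows "0 \<in> type_moves X S"
\<comment> \<open>With even weight, deleting a core vertex that carries an odd number of hairs
  already has value 0.\<close>
proof (cases "\<exists>A\<in>X. odd (hairs_at S A)")
  case True
  then show ?thesis using even vertex_moveI[where S = S and X = X] by force
next
  case False
  obtain A where "A \<in> fst ` S" using S(4) by auto
  then have AX: "A \<in> X" and ne: "{l. (A, l) \<in> S} \<noteq> {}" using S(3) by force+
  have fin: "finite {l. (A, l) \<in> S}"
    using finite_imageI[OF S(1), of snd] by (rule finite_subset[rotated]) force
  define m where "m = Min {l. (A, l) \<in> S}"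
  have m: "(A, m) \<in> S" using Min_in[OF fin ne] by (simp add: m_def)
  have m_le: "m \<le> l" if "(A, l) \<in> S" for l using fin that by (simp add: m_def)
  have pos: "0 < m" using m S(2) by force
  have evenA: "even (hairs_at S A)" using False AX by blast
  obtain l where l: "(A, l) \<in> S" "m < l"
  proof -
    have "{l. (A, l) \<in> S} \<noteq> {m}" using evenA by (auto simp: hairs_at_def)
    with ne obtain l where "(A, l) \<in> S" "l \<noteq> m" by blast
    with m_le[of l] that show thesis by force
  qed
  let ?T = "toggle (A, m - 1) (toggle (A, m) S)"
  have T: "?T = (if m = 1 then {} else {(A, m - 1)}) \<union> (S - {(A, m)})"
    using m pos m_le[of "m - 1"] by (auto simp: toggle_def)
  have odd: "odd (weight ?T)" using even S(1) pos by (auto simp: even_weight_toggle)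
  have "\<not> consecutive ?T"
  proof
    assume "consecutive ?T"
    then obtain B k where Bk: "?T = toggle (B, k) {(B, Suc k)}" by (auto simp: consecutive_def)
    have lT: "(A, l) \<in> ?T" unfolding T using l by auto
    then have B: "B = A" and k: "l = k \<or> l = Suc k"
      unfolding Bk by (auto simp: toggle_def split: if_splits)
    \<comment> \<open>If the shortened hair survives, its length is at least two below
      \<open>l\<close>, so the two are not consecutive. If it vanishes, \<open>A\<close> keeps an
      odd number of hairs, whereas \<open>2 \<le> l \<le> Suc k\<close> forces \<open>k > 0\<close>
      and hence exactly two hairs at \<open>A\<close>.\<close>
    show False
    proof (cases "m = 1")
      case False
      then have "(A, m - 1) \<in> ?T" unfolding T by auto
      then have "m - 1 = k \<or> m - 1 = Suc k"
        unfolding Bk by (auto simp: toggle_def split: if_splits)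
      then show False using k l(2) False pos by auto
    next
      case True
      then have "0 < k" using k l(2) by auto
      then have "even (hairs_at ?T A)"
        unfolding Bk B using even_hairs_at_toggle[of "{(A, Suc k)}" A k A] by (simp add: hairs_at_def)
      moreover have "odd (hairs_at ?T A)"
        using True evenA S(1) by (simp add: even_hairs_at_toggle)
      ultimately show False by blast
    qed
  qed
  then have "type_value ?T = 0" using odd by (simp add: type_value_odd)
  then show ?thesis using m pos by (intro hair_moveI[of A m S "m - 1" 0]) auto
qed

text \<open>Deleting the end vertex of the longer hair makes the pair cancel and gives 0; deleting
  its end edge leaves a single vertex in addition and gives 1; a core edge gives 2. For 3 the end
  vertex of the shorter hair is deleted, which leaves a nonempty type of even weight; if there is no
  shorter hair, \<open>A\<close> itself is deleted.\<close>

lemma less_four_in_type_moves: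
  assumes S: "finite S" "0 \<notin> snd ` S" "fst ` S \<subseteq> X"
    and con: "consecutive S" and x: "x < 4"
  shows "x \<in> type_moves X S"
proof -
  obtain A k where Ak: "S = toggle (A, k) {(A, Suc k)}" using con by (auto simp: consecutive_def)
  have AS: "(A, Suc k) \<in> S" by (simp add: Ak toggle_def)
  then have AX: "A \<in> X" using S(3) by force
  have "toggle (A, Suc k) S = toggle (A, k) (toggle (A, Suc k) {(A, Suc k)})"
    unfolding Ak by (rule toggle_commute)
  then have empty: "toggle (A, k) (toggle (A, Suc k) S) = {}" by (simp add: toggle_def)
  have odd: "odd (weight S)" unfolding Ak by (simp add: even_weight_toggle)
  have "x = 0 \<or> x = 1 \<or> x = 2 \<or> x = 3" using x by auto
  then show ?thesis
  proof (elim disjE)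
    assume "x = 0"
    then show ?thesis
      using AS empty by (intro hair_moveI[of A "Suc k" S k 0]) (auto simp: type_value_def)
  next
    assume "x = 1"
    then show ?thesis
      using AS empty by (intro hair_moveI[of A "Suc k" S k 1]) (auto simp: type_value_def)
  next
    assume "x = 2"
    then show ?thesis using odd by (simp add: type_moves_def)
  next
    assume x: "x = 3"
    show ?thesis
    proof (cases "k = 0")
      case True
      then have "hairs_at S A = 1" by (simp add: Ak hairs_at_def)
      then show ?thesis using odd AX x by (intro vertex_moveI[of A]) auto
    next
      case False
      then have k: "(A, k) \<in> S" by (simp add: Ak toggle_def)
      let ?T = "toggle (A, k - 1) (toggle (A, k) S)"
      have T: "?T = toggle (A, k - 1) {(A, Suc k)}" by (simp add: Ak)
      have "even (weight ?T)" unfolding T using False by (simp add: even_weight_toggle)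
      moreover have "?T \<noteq> {}" unfolding T by (auto simp: toggle_def)
      ultimately have "type_value ?T = 3" by (simp add: type_value_even)
      then show ?thesis using k False x by (intro hair_moveI[of A k S "k - 1" 0]) auto
    qed
  qed
qed

text \<open>The empty type has only core moves, of values 1 and 2, so its mex is 0. In the other
  cases the table of \<open>hair_move_value\<close> excludes the claimed value, and the preceding
  lemmas reach all smaller ones.\<close>

theorem mex_type_moves:
  assumes S: "finite S" "0 \<notin> snd ` S" "fst ` S \<subseteq> X" and X: "finite X" "odd (card X)"
  shows "mex (type_moves X S) = type_value S"
proof (cases "even (weight S)")
  case even: True
  show ?thesis
  proof (cases "S = {}")
    case True
    then show ?thesis
      by (intro mex_eqI) (auto simp: type_value_def type_moves_def weight_def hairs_at_def)
  next
    case False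
    show ?thesis
      unfolding type_value_even[OF even] if_not_P[OF False]
    proof (rule mex_eqI)
      show "3 \<notin> type_moves X S"
      proof
        assume "3 \<in> type_moves X S"
        then show False
        proof (cases rule: type_moves_cases)
          case 3
          then show ?thesis using hair_move_value(1)[OF S(1) 3(2,3,4)] even by simp
        qed (use even in \<open>auto simp: of_bool_def split: if_splits\<close>)
      qed
      have one: "1 \<in> type_moves X S" using even by (simp add: type_moves_def)
      fix x :: nat assume "x < 3"
      then have "x = 0 \<or> x = 1 \<or> x = 2" by auto
      then show "x \<in> type_moves X S"
        using one two_in_type_moves[OF S X even] zero_in_type_moves[OF S False even] by auto
    qed
  qed
next
  case odd: False
  show ?thesis
  proof (cases "consecutive S")
    case True
    show ?thesis
      unfolding type_value_odd[OF odd] if_P[OF True]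
    proof (rule mex_eqI)
      show "4 \<notin> type_moves X S"
      proof
        assume "4 \<in> type_moves X S"
        then show False
        proof (cases rule: type_moves_cases)
          case 3
          then show ?thesis using hair_move_value(2)[OF S(1) 3(2,3,4)] odd by simp
        qed (use odd in \<open>auto simp: of_bool_def split: if_splits\<close>)
      qed
    qed (rule less_four_in_type_moves[OF S True])
  next
    case False
    \<comment> \<open>A move to 0 would leave the empty type after shortening a hair by one.
      Toggling back the same two entries recovers \<open>S\<close> and shows that it is
      consecutive.\<close>
    have "0 \<notin> type_moves X S"
    proof
      assume "0 \<in> type_moves X S"
      then show False
      proof (cases rule: type_moves_cases)
        case (3 A j l d)
        then have *: "toggle (A, j) (toggle (A, l) S) = {}" "l = Suc j"
          using hair_move_value(3)[OF S(1) 3(2,3,4) odd] by auto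
        have "S = toggle (A, l) (toggle (A, j) (toggle (A, j) (toggle (A, l) S)))" by simp
        also have "\<dots> = toggle (A, l) (toggle (A, j) {})" by (simp only: *(1))
        also have "\<dots> = toggle (A, j) (toggle (A, Suc j) {})"
          unfolding *(2) by (rule toggle_commute)
        also have "toggle (A, Suc j) {} = {(A, Suc j)}" by (simp add: toggle_def)
        finally have "consecutive S" unfolding consecutive_def by blast
        with False show False ..
      qed (use odd in \<open>auto split: if_splits\<close>)
    qed
    then show ?thesis
      unfolding type_value_odd[OF odd] using False by (simp add: mex_eqI)
  qed
qed

subsection \<open>Attaching paths\<close>

lemma path_edges_Nil [simp]: "path_edges [] = {}"
  and path_edges_single [simp]: "path_edges [x] = {}"
  by (simp_all add: path_edges_def)

lemma path_edges_snoc: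
  "path_edges ((x # xs) @ [y]) = insert {last (x # xs), y} (path_edges (x # xs))"
proof -
  have "path_edges (zs @ [y]) = insert {last zs, y} (path_edges zs)" if "zs \<noteq> []" for zs
  proof -
    have n: "{i. Suc i < length (zs @ [y])} = insert (length zs - 1) {i. Suc i < length zs}"
      using that by (cases zs) auto
    have "path_edges (zs @ [y]) = (\<lambda>i. {(zs @ [y]) ! i, (zs @ [y]) ! Suc i}) ` {i. Suc i < length (zs @ [y])}"
      by (auto simp: path_edges_def)
    also have "\<dots> = insert {last zs, y} ((\<lambda>i. {zs ! i, zs ! Suc i}) ` {i. Suc i < length zs})"
      unfolding n using that by (auto simp: nth_append last_conv_nth)
    finally show ?thesis by (auto simp: path_edges_def)
  qed
  then show ?thesis by blast
qed

lemma path_edges_append: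
  "path_edges ((x # xs) @ y # ys) =
    insert {last (x # xs), y} (path_edges (x # xs) \<union> path_edges (y # ys))"
proof (induction ys rule: rev_induct)
  case Nil
  then show ?case by (simp only: path_edges_snoc path_edges_single) simp
next
  case (snoc z zs)
  then show ?case
    using path_edges_snoc[of x "xs @ y # zs" z] path_edges_snoc[of y zs z] by auto
qed

lemma path_edges_subset: "e \<in> path_edges xs \<Longrightarrow> e \<subseteq> set xs"
  by (auto simp: path_edges_def)

text \<open>Splits a hair at an edge into the part that stays attached and the part that is cut off.
  The attaching vertex \<open>x\<close> is not part of the hair, so \<open>ys\<close> is empty when
  the edge is the joining one.\<close>

lemma path_edges_cases:
  assumes "e \<in> path_edges (x # xs)"
  obtains ys y zs where "xs = ys @ y # zs" "e = {last (x # ys), y}"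
proof -
  obtain i where i: "i < length xs" "e = {(x # xs) ! i, xs ! i}"
    using assms by (auto simp: path_edges_def)
  have "last (x # take i xs) = (x # xs) ! i"
    using i(1) by (cases i) (simp_all add: take_Suc_conv_app_nth)
  then show ?thesis using that[OF id_take_nth_drop[OF i(1)]] i(2) by simp
qed

definition path_graph :: "'a list \<Rightarrow> 'a graph" where
  "path_graph xs = Graph (set xs) (path_edges xs)"

lemma verts_path_graph [simp]: "verts (path_graph ps) = set ps"
  by (simp add: path_graph_def)

definition attach :: "'a graph \<Rightarrow> 'a \<Rightarrow> 'a list \<Rightarrow> 'a graph" where
  "attach K A ps = Graph (verts K \<union> set ps) (edges K \<union> path_edges (A # ps))"

text \<open>The unit step by which a hair grows outwards.\<close>

definition pendant :: "'a graph \<Rightarrow> 'a \<Rightarrow> 'a \<Rightarrow> 'a graph" where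
  "pendant K u w = Graph (insert w (verts K)) (insert {u, w} (edges K))"

lemma attach_Nil [simp]: "attach K A [] = K"
  by (simp add: attach_def)

lemma attach_snoc: "attach K A (ps @ [w]) = pendant (attach K A ps) (last (A # ps)) w"
  unfolding attach_def pendant_def
  using path_edges_snoc[of A ps w] by simp

lemma verts_attach [simp]: "verts (attach K A ps) = verts K \<union> set ps"
  by (simp add: attach_def)

lemma path_graph_Cons: "path_graph (x # xs) = attach (Graph {x} {}) x xs"
  by (simp add: path_graph_def attach_def)

text \<open>Reduces statements about attached paths to a single pendant vertex. The step case
  supplies that the old end is present and the new vertex is fresh, which is what the lemmas on
  \<open>pendant\<close> ask for.\<close>

lemma attach_induct [consumes 3, case_names Nil snoc]:
  assumes "A \<in> verts K" "distinct ps" "set ps \<inter> verts K = {}"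
    and "P K []"
    and "\<And>qs w. distinct (qs @ [w]) \<Longrightarrow> set (qs @ [w]) \<inter> verts K = {} \<Longrightarrow>
      last (A # qs) \<in> verts (attach K A qs) \<Longrightarrow> w \<notin> verts (attach K A qs) \<Longrightarrow>
      P (attach K A qs) qs \<Longrightarrow> P (pendant (attach K A qs) (last (A # qs)) w) (qs @ [w])"
  shows "P (attach K A ps) ps"
  using assms(2,3)
proof (induction ps rule: rev_induct)
  case Nil
  then show ?case using assms(4) by simp
next
  case (snoc w qs)
  show ?case
    unfolding attach_snoc
  proof (rule assms(5))
    show "last (A # qs) \<in> verts (attach K A qs)" using assms(1) by (cases qs) auto
  qed (use snoc in auto)
qed

lemma finite_simple_pendant:
  "finite_simple_graph K \<Longrightarrow> u \<in> verts K \<Longrightarrow> w \<notin> verts K \<Longrightarrow> finite_simple_graph (pendant K u w)"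
  by (auto simp: finite_simple_graph_def pendant_def card_insert_if)

lemma finite_simple_attach:
  assumes "finite_simple_graph K" "A \<in> verts K" "distinct ps" "set ps \<inter> verts K = {}"
  shows "finite_simple_graph (attach K A ps)"
  using assms(2-4)
  by (induction rule: attach_induct) (simp_all add: assms(1) finite_simple_pendant)

lemma pendant_edge_new: "finite_simple_graph K \<Longrightarrow> w \<notin> verts K \<Longrightarrow> {u, w} \<notin> edges K"
  using edge_subset_verts by blast

lemma card_attach:
  assumes "finite_simple_graph K" "A \<in> verts K" "distinct ps" "set ps \<inter> verts K = {}"
  shows "card (verts (attach K A ps)) = card (verts K) + length ps"
    and "card (edges (attach K A ps)) = card (edges K) + length ps"
proof -
  show "card (verts (attach K A ps)) = card (verts K) + length ps"
    using assms by (simp add: card_Un_disjoint distinct_card finite_simple_graph_def Int_commute)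
  show "card (edges (attach K A ps)) = card (edges K) + length ps"
    using assms(2-4)
  proof (induction rule: attach_induct)
    case (snoc qs w)
    have "finite_simple_graph (attach K A qs)"
      using snoc assms by (intro finite_simple_attach) auto
    from pendant_edge_new[OF this snoc(4)] finite_edges[OF this] snoc(5) show ?case
      by (simp add: pendant_def del: last.simps)
  qed simp
qed

lemma degree_pendant:
  assumes "finite_simple_graph K" "w \<notin> verts K" "v \<noteq> w"
  shows "degree (pendant K u w) v = degree K v + of_bool (v = u)"
proof -
  have "{e \<in> edges (pendant K u w). v \<in> e} =
      (if v = u then {{u, w}} else {}) \<union> {e \<in> edges K. v \<in> e}"
    using assms(3) by (auto simp: pendant_def)
  then show ?thesis
    using finite_edges[OF assms(1)] pendant_edge_new[OF assms(1,2)] by (simp add: degree_def)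
qed

lemma degree_attach:
  assumes "finite_simple_graph K" "A \<in> verts K" "distinct ps" "set ps \<inter> verts K = {}" "v \<in> verts K"
  shows "degree (attach K A ps) v = degree K v + of_bool (v = A \<and> ps \<noteq> [])"
  using assms(2-4)
proof (induction rule: attach_induct)
  case (snoc qs w)
  let ?G = "attach K A qs"
  have fin: "finite_simple_graph ?G"
    using snoc assms by (intro finite_simple_attach) auto
  have vw: "v \<noteq> w" using snoc assms(5) by auto
  have "last qs \<noteq> v" if "qs \<noteq> []"
  proof -
    have "last qs \<in> set (qs @ [w])" using that by simp
    then show ?thesis using snoc(2) assms(5) by blast
  qed
  then have "v = last (A # qs) \<longleftrightarrow> v = A \<and> qs = []" by (cases "qs = []") auto
  then have "degree (pendant ?G (last (A # qs)) w) v = degree ?G v + of_bool (v = A \<and> qs = [])"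
    unfolding degree_pendant[OF fin snoc(4) vw] by simp
  then show ?case using snoc by auto
qed simp

lemma bipartite_pendant:
  assumes "finite_simple_graph K" "u \<in> verts K" "w \<notin> verts K" "bipartite K"
  shows "bipartite (pendant K u w)"
proof -
  obtain L where L: "\<forall>e \<in> edges K. card (e \<inter> L) = 1"
    using assms(4) by (auto simp: bipartite_def)
  \<comment> \<open>The new vertex is coloured opposite to \<open>u\<close>. As \<open>L\<close> is
    not confined to the vertices of \<open>K\<close> it may already contain \<open>w\<close>, hence
    the subtraction.\<close>
  define M where "M = (if u \<in> L then L - {w} else insert w L)"
  have "e \<inter> M = e \<inter> L" if "e \<in> edges K" for e
    using edge_subset_verts[OF assms(1) that] assms(3) by (auto simp: M_def)
  moreover have "{u, w} \<inter> M = (if u \<in> L then {u} else {w})"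
    using assms(2,3) by (auto simp: M_def)
  ultimately have "\<forall>e \<in> edges (pendant K u w). card (e \<inter> M) = 1"
    using L by (auto simp: pendant_def)
  then show ?thesis by (auto simp: bipartite_def)
qed

lemma bipartite_attach:
  assumes "finite_simple_graph K" "A \<in> verts K" "distinct ps" "set ps \<inter> verts K = {}" "bipartite K"
  shows "bipartite (attach K A ps)"
  using assms(2-4)
proof (induction rule: attach_induct)
  case (snoc qs w)
  then show ?case
    using assms by (intro bipartite_pendant finite_simple_attach) auto
qed (rule assms(5))

lemma finite_simple_path_graph: "distinct ps \<Longrightarrow> finite_simple_graph (path_graph ps)"
  by (cases ps) (auto simp: path_graph_Cons intro!: finite_simple_attach,
      auto simp: finite_simple_graph_def path_graph_def)

lemma nim_value_path_graph:
  assumes "distinct ps"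
  shows "nim_value (path_graph ps) = path_value (length ps)"
proof -
  have single: "finite_simple_graph (Graph {x} {})" "bipartite (Graph {x} {})" for x :: 'a
    by (auto simp: finite_simple_graph_def bipartite_def)
  have "bipartite (path_graph ps)"
  proof (cases ps)
    case (Cons x xs)
    then show ?thesis
      unfolding Cons path_graph_Cons using assms[unfolded Cons] single by (intro bipartite_attach) auto
  qed (simp add: path_graph_def bipartite_def)
  moreover have "card (verts (path_graph ps)) = length ps"
    using assms by (simp add: path_graph_def distinct_card)
  moreover have "card (edges (path_graph ps)) = length ps - 1"
  proof (cases ps)
    case (Cons x xs)
    then show ?thesis
      unfolding Cons path_graph_Cons using assms[unfolded Cons] single by (subst card_attach) auto
  qed (simp add: path_graph_def)
  ultimately show ?thesis
    using nim_value_bipartite[OF finite_simple_path_graph[OF assms]] by (auto simp: path_value_def)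
qed

lemma delete_vertex_attach:
  assumes "finite_simple_graph K" "A \<in> verts K" "distinct (qs @ w # rs)" "set (qs @ w # rs) \<inter> verts K = {}"
  shows "delete_vertex (attach K A (qs @ w # rs)) w = disjoint_union (attach K A qs) (path_graph rs)"
proof -
  have K: "w \<notin> e" if "e \<in> edges K" for e
    using edge_subset_verts[OF assms(1) that] assms(4) by auto
  have Q: "w \<notin> e" if "e \<in> path_edges (A # qs)" for e
    using path_edges_subset[OF that] assms by auto
  have R: "w \<notin> e" if "e \<in> path_edges rs" for e
    using path_edges_subset[OF that] assms by auto
  have wrs: "path_edges (w # rs) = path_edges rs \<union> (if rs = [] then {} else {{w, hd rs}})"
    using path_edges_append[of w "[]"] by (cases rs) auto
  have w: "w \<notin> verts K" using assms(4) by auto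
  show ?thesis
    using path_edges_append[of A qs w rs] K Q R w assms(3)
    by (auto simp: delete_vertex_def disjoint_union_def attach_def path_graph_def wrs split: if_splits)
qed

lemma delete_edge_attach:
  assumes "finite_simple_graph K" "A \<in> verts K" "distinct (qs @ w # rs)" "set (qs @ w # rs) \<inter> verts K = {}"
  shows "delete_edge (attach K A (qs @ w # rs)) {last (A # qs), w} =
    disjoint_union (attach K A qs) (path_graph (w # rs))"
proof -
  have l: "last (A # qs) \<in> insert A (set qs)" by (cases qs) auto
  then have "last (A # qs) \<notin> set (w # rs)" using assms by auto
  then have "{last (A # qs), w} \<notin> path_edges (w # rs)"
    using path_edges_subset by blast
  moreover have "{last (A # qs), w} \<notin> path_edges (A # qs)"
    using path_edges_subset[of "{last (A # qs), w}" "A # qs"] assms by auto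
  moreover have "{last (A # qs), w} \<notin> edges K"
    using pendant_edge_new[OF assms(1)] assms(4) by auto
  ultimately show ?thesis
    using path_edges_append[of A qs w rs]
    by (auto simp: delete_edge_def disjoint_union_def attach_def path_graph_def)
qed

text \<open>The involution exchanges the vertices at equal positions of the two hairs. No edge is
  flipped because each hair edge is carried to the other hair, from which it differs.\<close>

lemma swap_equal_hairs:
  assumes K: "finite_simple_graph K" "A \<in> verts K"
    and ps: "distinct (ps @ qs)" "set (ps @ qs) \<inter> verts K = {}" "length ps = length qs"
  obtains \<tau> where "simplicial_involution (attach (attach K A ps) A qs) \<tau>"
    and "fixed_subgraph (attach (attach K A ps) A qs) \<tau> = K"
    and "\<And>v. v \<notin> set ps \<union> set qs \<Longrightarrow> \<tau> v = v"
    and "\<And>v. v \<in> set ps \<union> set qs \<Longrightarrow> \<tau> v \<noteq> v"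
proof -
  let ?n = "length ps" and ?G = "attach (attach K A ps) A qs"
  \<comment> \<open>The two zips list the exchange in both directions; the default value makes
    \<tau> the identity elsewhere.\<close>
  define \<tau> where "\<tau> v = (case map_of (zip ps qs @ zip qs ps) v of None \<Rightarrow> v | Some w \<Rightarrow> w)" for v
  have dps: "distinct ps" "distinct qs" "set ps \<inter> set qs = {}" using ps by auto
  have tp: "\<tau> (ps ! i) = qs ! i" if "i < ?n" for i
    unfolding \<tau>_def using that ps(3) dps map_of_zip_nth[of ps qs i] by (simp add: map_add_def)
  have tq: "\<tau> (qs ! i) = ps ! i" if "i < ?n" for i
  proof -
    have "qs ! i \<notin> set ps" using that dps ps(3) by (metis disjoint_iff nth_mem)
    then have "map_of (zip ps qs) (qs ! i) = None" using ps(3) by (simp add: map_of_zip_is_None)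
    moreover have "map_of (zip qs ps) (qs ! i) = Some (ps ! i)"
      using that ps(3) dps by (intro map_of_zip_nth) auto
    ultimately have "map_of (zip ps qs @ zip qs ps) (qs ! i) = Some (ps ! i)"
      by (simp only: map_of_append map_add_def option.case)
    then show ?thesis by (simp add: \<tau>_def)
  qed
  have fixed: "\<tau> v = v" if "v \<notin> set ps \<union> set qs" for v
  proof -
    have "map_of (zip ps qs) v = None" "map_of (zip qs ps) v = None"
      using that ps(3) by (simp_all add: map_of_zip_is_None)
    then show ?thesis unfolding \<tau>_def by (simp add: map_add_def)
  qed
  have range: "v \<in> set ps \<and> \<tau> v \<in> set qs \<and> \<tau> (\<tau> v) = v \<or> v \<in> set qs \<and> \<tau> v \<in> set ps \<and> \<tau> (\<tau> v) = v"
    if "v \<in> set ps \<union> set qs" for v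
    using that tp tq ps(3) by (auto simp: in_set_conv_nth)
  have moved: "\<tau> v \<noteq> v" if "v \<in> set ps \<union> set qs" for v
    using range[OF that] dps(3) by auto
  have inv: "\<tau> (\<tau> v) = v" for v
    using range[of v] fixed by (cases "v \<in> set ps \<union> set qs") auto
  have fixK: "\<tau> v = v" if "v \<in> verts K" for v
    using that ps(2) by (intro fixed) auto
  \<comment> \<open>Both paths are indexed from \<open>A\<close>, which sits at position 0 and is
    fixed, so the joining edges are treated like the inner ones.\<close>
  have tpA: "\<tau> ((A # ps) ! i) = (A # qs) ! i" "\<tau> ((A # qs) ! i) = (A # ps) ! i" if "i \<le> ?n" for i
    using that tp tq fixK[OF K(2)] by (cases i; simp)+
  have edge: "\<tau> ` e \<in> edges ?G \<and> (\<exists>v\<in>e. \<tau> v \<noteq> v) \<and> \<tau> ` e \<noteq> e"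
    if e: "e \<in> path_edges (A # ps) \<union> path_edges (A # qs)" for e
  proof -
    have *: "\<tau> ` e \<in> path_edges (A # zs) \<and> (\<exists>v\<in>e. \<tau> v \<noteq> v) \<and> \<tau> ` e \<noteq> e"
      if e: "e \<in> path_edges (A # ys)" and yz: "(ys, zs) = (ps, qs) \<or> (ys, zs) = (qs, ps)" for ys zs
    proof -
      obtain i where i: "i < length ys" "e = {(A # ys) ! i, (A # ys) ! Suc i}"
        using e by (auto simp: path_edges_def)
      have le: "i < length zs" "i \<le> ?n" "Suc i \<le> ?n" using i(1) yz ps(3) by auto
      have img: "\<tau> ` e = {(A # zs) ! i, (A # zs) ! Suc i}"
        using i(2) tpA[OF le(2)] tpA[OF le(3)] yz by auto
      have yi: "ys ! i \<in> set ys" using i(1) by simp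
      have "ys ! i \<in> e" using i(2) by simp
      moreover have "\<tau> (ys ! i) \<noteq> ys ! i" using yz yi by (intro moved) auto
      moreover have "\<tau> ` e \<in> path_edges (A # zs)"
        unfolding img path_edges_def using le(1) by auto
      \<comment> \<open>This vertex of \<open>e\<close> lies on one hair, while the image of
        \<open>e\<close> lies on the path along the other, so \<open>e\<close> is not mapped to
        itself.\<close>
      moreover have "ys ! i \<notin> set (A # zs)" using yi yz dps(3) ps(2) K(2) by auto
      ultimately show ?thesis using path_edges_subset by blast
    qed
    show ?thesis using e *[of ps qs] *[of qs ps] by (auto simp: attach_def)
  qed
  have edgeK: "\<tau> ` e = e \<and> (\<forall>v\<in>e. \<tau> v = v)" if "e \<in> edges K" for e
    using edge_subset_verts[OF K(1) that] fixK by force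
  have edges: "edges ?G = edges K \<union> (path_edges (A # ps) \<union> path_edges (A # qs))"
    by (auto simp: attach_def)
  show thesis
  proof
    show "simplicial_involution ?G \<tau>"
      unfolding simplicial_involution_def
    proof (intro conjI ballI allI impI)
      fix v assume "v \<in> verts ?G"
      then show "\<tau> v \<in> verts ?G" using range[of v] fixK by auto
    next
      fix e assume "e \<in> edges ?G"
      then show "\<tau> ` e \<in> edges ?G" using edge edgeK unfolding edges by (metis Un_iff)
    next
      fix e v assume "e \<in> edges ?G" "\<tau> ` e = e" "v \<in> e"
      then show "\<tau> v = v" using edge edgeK unfolding edges by (metis Un_iff)
    qed (rule inv)
    have "{v \<in> verts ?G. \<tau> v = v} = verts K" using moved fixK by auto
    moreover have "{e \<in> edges ?G. \<forall>v\<in>e. \<tau> v = v} = edges K"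
      unfolding edges using edge edgeK by blast
    ultimately show "fixed_subgraph ?G \<tau> = K" by (simp add: fixed_subgraph_def)
  qed (use fixed moved in auto)
qed

subsection \<open>Odd cores with hairs\<close>

text \<open>Empty hairs are allowed, so that a hair cut off completely still leaves an entry of the
  same shape. Since a hair system is a set, empty hairs at one vertex merge.\<close>

definition hair_system :: "'a graph \<Rightarrow> ('a \<times> 'a list) set \<Rightarrow> bool" where
  "hair_system C H \<longleftrightarrow> finite H \<and>
    (\<forall>(A, ps) \<in> H. A \<in> verts C \<and> distinct ps \<and> set ps \<inter> verts C = {}) \<and>
    (\<forall>h \<in> H. \<forall>h' \<in> H. h \<noteq> h' \<longrightarrow> set (snd h) \<inter> set (snd h') = {})"

definition attach_hairs :: "'a graph \<Rightarrow> ('a \<times> 'a list) set \<Rightarrow> 'a graph" where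
  "attach_hairs C H = Graph (verts C \<union> (\<Union>h\<in>H. set (snd h)))
    (edges C \<union> (\<Union>h\<in>H. path_edges (fst h # snd h)))"

definition hair_type :: "('a \<times> 'a list) set \<Rightarrow> ('a \<times> nat) set" where
  "hair_type H = {(A, l). 0 < l \<and> odd (card {ps. (A, ps) \<in> H \<and> length ps = l})}"

lemma attach_hairs_empty [simp]: "attach_hairs C {} = C"
  by (simp add: attach_hairs_def)

lemma attach_hairs_insert:
  "attach_hairs C (insert (A, ps) H) = attach (attach_hairs C H) A ps"
  by (simp add: attach_hairs_def attach_def Un_ac)

lemma verts_attach_hairs: "verts (attach_hairs C H) = verts C \<union> (\<Union>h\<in>H. set (snd h))"
  by (simp add: attach_hairs_def)

lemma edges_attach_hairs:
  "edges (attach_hairs C H) = edges C \<union> (\<Union>h\<in>H. path_edges (fst h # snd h))"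
  by (simp add: attach_hairs_def)

text \<open>Turns pairwise disjointness into freshness with respect to the graph built so far, the
  form in which \<open>attach\<close> needs it.\<close>

lemma hair_system_insert:
  assumes "(A, ps) \<notin> H"
  shows "hair_system C (insert (A, ps) H) \<longleftrightarrow>
    hair_system C H \<and> A \<in> verts C \<and> distinct ps \<and> set ps \<inter> verts (attach_hairs C H) = {}"
proof -
  have "set ps \<inter> verts (attach_hairs C H) = {} \<longleftrightarrow>
      set ps \<inter> verts C = {} \<and> (\<forall>h\<in>H. set ps \<inter> set (snd h) = {})"
    unfolding verts_attach_hairs by blast
  moreover have "(\<forall>h \<in> insert (A, ps) H. \<forall>h' \<in> insert (A, ps) H. h \<noteq> h' \<longrightarrow> set (snd h) \<inter> set (snd h') = {})
    \<longleftrightarrow> (\<forall>h \<in> H. \<forall>h' \<in> H. h \<noteq> h' \<longrightarrow> set (snd h) \<inter> set (snd h') = {}) \<and>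
      (\<forall>h\<in>H. set ps \<inter> set (snd h) = {})" (is "?L \<longleftrightarrow> ?R")
  proof
    assume ?L
    moreover have "(A, ps) \<noteq> h" if "h \<in> H" for h using that assms by blast
    ultimately show ?R by (metis insertCI snd_conv)
  next
    assume ?R
    then show ?L by (metis Int_commute insertE snd_conv)
  qed
  ultimately show ?thesis unfolding hair_system_def by auto
qed

lemma hair_system_induct [consumes 1, case_names empty insert]:
  assumes "hair_system C H"
    and "P {}"
    and "\<And>A ps H. hair_system C H \<Longrightarrow> (A, ps) \<notin> H \<Longrightarrow> A \<in> verts C \<Longrightarrow> distinct ps \<Longrightarrow>
      set ps \<inter> verts (attach_hairs C H) = {} \<Longrightarrow> P H \<Longrightarrow> P (insert (A, ps) H)"
  shows "P H"
proof -
  have "finite H" using assms(1) by (simp add: hair_system_def)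
  then show ?thesis
    using assms(1)
  proof (induction H rule: finite_induct)
    case (insert h H)
    obtain A ps where "h = (A, ps)" by (cases h)
    with insert show ?case
      using hair_system_insert[of A ps H C] assms(3)[of H A ps] by blast
  qed (rule assms(2))
qed

lemma hair_system_finite: "hair_system C H \<Longrightarrow> finite H"
  by (simp add: hair_system_def)

lemma hair_type_empty [simp]: "hair_type {} = {}"
  by (simp add: hair_type_def)

lemma hair_type_insert:
  assumes "finite H" "(A, ps) \<notin> H"
  shows "hair_type (insert (A, ps) H) = toggle (A, length ps) (hair_type H)"
proof -
  let ?L = "\<lambda>H B l. {qs. (B, qs) \<in> H \<and> length qs = l}"
  have fin: "finite (?L H B l)" for B l
    using finite_imageI[OF assms(1), of snd] by (rule finite_subset[rotated]) force
  have "card (?L (insert (A, ps) H) B l) =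
      card (?L H B l) + of_bool ((B, l) = (A, length ps))" for B l
  proof (cases "(B, l) = (A, length ps)")
    case True
    then have "?L (insert (A, ps) H) B l = insert ps (?L H B l)" by auto
    then show ?thesis using True fin assms(2) by simp
  next
    case False
    then have "?L (insert (A, ps) H) B l = ?L H B l" by auto
    then show ?thesis using False by simp
  qed
  then show ?thesis
    unfolding hair_type_def toggle_def by auto
qed

lemma hair_type_properties:
  assumes "hair_system C H"
  shows "finite (hair_type H)" "0 \<notin> snd ` hair_type H" "fst ` hair_type H \<subseteq> verts C"
proof -
  show "finite (hair_type H)"
    using assms
    by (induction rule: hair_system_induct) (simp_all add: hair_type_insert hair_system_finite)
  show "0 \<notin> snd ` hair_type H" by (auto simp: hair_type_def)
  have "\<exists>ps. (A, ps) \<in> H" if "(A, l) \<in> hair_type H" for A l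
  proof (rule ccontr)
    assume "\<nexists>ps. (A, ps) \<in> H"
    then have "{ps. (A, ps) \<in> H \<and> length ps = l} = {}" by blast
    then have "even (card {ps. (A, ps) \<in> H \<and> length ps = l})" by (simp only: card.empty even_zero)
    then show False using that by (simp add: hair_type_def)
  qed
  then show "fst ` hair_type H \<subseteq> verts C" using assms by (force simp: hair_system_def)
qed

lemma finite_simple_attach_hairs:
  assumes "finite_simple_graph C" "hair_system C H"
  shows "finite_simple_graph (attach_hairs C H)"
  using assms(2)
  by (induction rule: hair_system_induct)
    (simp_all add: assms(1) attach_hairs_insert finite_simple_attach verts_attach_hairs)

lemma bipartite_attach_hairs:
  assumes "finite_simple_graph C" "bipartite C" "hair_system C H"
  shows "bipartite (attach_hairs C H)"
  using assms(3)
  by (induction rule: hair_system_induct)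
    (simp_all add: assms attach_hairs_insert bipartite_attach finite_simple_attach_hairs
      verts_attach_hairs)

text \<open>The link between graphs and types: these three parities are all that the formula for
  bipartite graphs needs after a move on the core. Each new hair adds its length to both counts and,
  if nonempty, 1 to the degree of its attaching vertex.\<close>

lemma attach_hairs_parity:
  assumes C: "finite_simple_graph C" and H: "hair_system C H"
  shows "even (card (verts (attach_hairs C H))) \<longleftrightarrow>
      (even (card (verts C)) \<longleftrightarrow> even (weight (hair_type H)))"
    and "even (card (edges (attach_hairs C H))) \<longleftrightarrow>
      (even (card (edges C)) \<longleftrightarrow> even (weight (hair_type H)))"
    and "v \<in> verts C \<Longrightarrow> even (degree (attach_hairs C H) v) \<longleftrightarrow>
      (even (degree C v) \<longleftrightarrow> even (hairs_at (hair_type H) v))"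
proof -
  let ?P = "\<lambda>H. (even (card (verts (attach_hairs C H))) \<longleftrightarrow>
      (even (card (verts C)) \<longleftrightarrow> even (weight (hair_type H)))) \<and>
    (even (card (edges (attach_hairs C H))) \<longleftrightarrow>
      (even (card (edges C)) \<longleftrightarrow> even (weight (hair_type H)))) \<and>
    (v \<in> verts C \<longrightarrow> (even (degree (attach_hairs C H) v) \<longleftrightarrow>
      (even (degree C v) \<longleftrightarrow> even (hairs_at (hair_type H) v))))"
  have "?P H"
    using H
  proof (induction rule: hair_system_induct)
    case empty
    then show ?case by (simp add: weight_def hairs_at_def)
  next
    case (insert A ps H)
    let ?K = "attach_hairs C H"
    have K: "finite_simple_graph ?K" "A \<in> verts ?K"
      using finite_simple_attach_hairs[OF C insert(1)] insert(3) by (auto simp: verts_attach_hairs)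
    note t = hair_type_insert[OF hair_system_finite[OF insert(1)] insert(2)]
    note f = hair_type_properties(1)[OF insert(1)]
    have v: "v \<in> verts ?K" if "v \<in> verts C" using that by (simp add: verts_attach_hairs)
    note ca = card_attach[OF K insert(4,5)]
    have 1: "even (card (verts (attach_hairs C (insert (A, ps) H)))) \<longleftrightarrow>
      (even (card (verts C)) \<longleftrightarrow> even (weight (hair_type (insert (A, ps) H))))"
      unfolding attach_hairs_insert ca t even_weight_toggle[OF f] using insert.IH by auto
    have 2: "even (card (edges (attach_hairs C (insert (A, ps) H)))) \<longleftrightarrow>
      (even (card (edges C)) \<longleftrightarrow> even (weight (hair_type (insert (A, ps) H))))"
      unfolding attach_hairs_insert ca t even_weight_toggle[OF f] using insert.IH by auto
    have 3: "even (degree (attach_hairs C (insert (A, ps) H)) v) \<longleftrightarrow>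
      (even (degree C v) \<longleftrightarrow> even (hairs_at (hair_type (insert (A, ps) H)) v))" if "v \<in> verts C"
      unfolding attach_hairs_insert degree_attach[OF K insert(4,5) v[OF that]] t
        even_hairs_at_toggle[OF f]
      using insert.IH that by auto
    show ?case using 1 2 3 by blast
  qed
  then show "even (card (verts (attach_hairs C H))) \<longleftrightarrow>
      (even (card (verts C)) \<longleftrightarrow> even (weight (hair_type H)))"
    and "even (card (edges (attach_hairs C H))) \<longleftrightarrow>
      (even (card (edges C)) \<longleftrightarrow> even (weight (hair_type H)))"
    and "v \<in> verts C \<Longrightarrow> even (degree (attach_hairs C H) v) \<longleftrightarrow>
      (even (degree C v) \<longleftrightarrow> even (hairs_at (hair_type H) v))"
    by blast+
qed

lemma hair_system_remove:
  assumes "hair_system C H" "(A, ps) \<in> H"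
  shows "hair_system C (H - {(A, ps)})" "A \<in> verts C" "distinct ps"
    "set ps \<inter> verts (attach_hairs C (H - {(A, ps)})) = {}"
    "attach_hairs C H = attach (attach_hairs C (H - {(A, ps)})) A ps"
    "hair_type H = toggle (A, length ps) (hair_type (H - {(A, ps)}))"
proof -
  have H: "insert (A, ps) (H - {(A, ps)}) = H" using assms(2) by blast
  show 1: "hair_system C (H - {(A, ps)})" "A \<in> verts C" "distinct ps"
    "set ps \<inter> verts (attach_hairs C (H - {(A, ps)})) = {}"
    using hair_system_insert[of A ps "H - {(A, ps)}" C] assms(1) unfolding H by auto
  show "attach_hairs C H = attach (attach_hairs C (H - {(A, ps)})) A ps"
    using attach_hairs_insert[of C A ps "H - {(A, ps)}"] unfolding H .
  show "hair_type H = toggle (A, length ps) (hair_type (H - {(A, ps)}))"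
    using hair_type_insert[OF hair_system_finite[OF 1(1)], of A ps] unfolding H by simp
qed

lemma hair_system_truncate:
  assumes "hair_system C H" "(A, ps) \<in> H" "set qs \<subseteq> set ps" "distinct qs" "length qs < length ps"
  defines "H' \<equiv> insert (A, qs) (H - {(A, ps)})"
  shows "hair_system C H'"
    "hair_type H' = toggle (A, length qs) (toggle (A, length ps) (hair_type H))"
    "(\<Sum>h\<in>H'. length (snd h)) < (\<Sum>h\<in>H. length (snd h))"
proof -
  let ?K = "H - {(A, ps)}"
  note r = hair_system_remove[OF assms(1,2)]
  have K: "hair_type ?K = toggle (A, length ps) (hair_type H)" unfolding r(6) by simp
  have fin: "finite ?K" using r(1) by (rule hair_system_finite)
  \<comment> \<open>The shortened hair can collide with a remaining one only if it is empty. The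
    insertion then has no effect, and neither does toggling a pair of length 0.\<close>
  have nil: "qs = []" if "(A, qs) \<in> ?K"
  proof -
    have "set qs \<subseteq> verts (attach_hairs C ?K)" using that by (auto simp: verts_attach_hairs)
    then have "x \<notin> set qs" for x using assms(3) r(4) by blast
    then show ?thesis by (cases qs) auto
  qed
  have le: "(\<Sum>h\<in>H'. length (snd h)) = (\<Sum>h\<in>?K. length (snd h)) + length qs"
  proof (cases "(A, qs) \<in> ?K")
    case True
    then have "H' = ?K" unfolding H'_def by blast
    then show ?thesis using nil[OF True] by simp
  next
    case False
    then show ?thesis unfolding H'_def using fin by simp
  qed
  have "finite H" using assms(1) by (rule hair_system_finite)
  then have "(\<Sum>h\<in>H. length (snd h)) = length ps + (\<Sum>h\<in>?K. length (snd h))"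
    using sum.remove[of H "(A, ps)" "\<lambda>h. length (snd h)"] assms(2) by simp
  then show "(\<Sum>h\<in>H'. length (snd h)) < (\<Sum>h\<in>H. length (snd h))" using le assms(5) by simp
  show "hair_system C H'"
  proof (cases "(A, qs) \<in> ?K")
    case True
    then have "H' = ?K" unfolding H'_def by blast
    then show ?thesis using r(1) by simp
  next
    case False
    then show ?thesis
      unfolding H'_def hair_system_insert[OF False] using r(1-4) assms(3,4) by blast
  qed
  show "hair_type H' = toggle (A, length qs) (toggle (A, length ps) (hair_type H))"
  proof (cases "(A, qs) \<in> ?K")
    case True
    then have "H' = ?K" unfolding H'_def by blast
    then show ?thesis using K nil[OF True] by simp
  next
    case False
    show ?thesis unfolding H'_def hair_type_insert[OF fin False] K ..
  qed
qed

text \<open>The properties of an odd cycle that determine the values of its hairballs.\<close>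

definition odd_core :: "'a graph \<Rightarrow> bool" where
  "odd_core C \<longleftrightarrow> finite_simple_graph C \<and> odd (card (verts C)) \<and> odd (card (edges C)) \<and>
    (\<forall>v\<in>verts C. even (degree C v) \<and> (\<exists>e\<in>edges C. v \<in> e)) \<and>
    (\<forall>e\<in>edges C. bipartite (delete_edge C e))"

text \<open>In this case nothing cancels, so the type lists the nonempty hairs themselves.\<close>

definition reduced :: "('a \<times> 'a list) set \<Rightarrow> bool" where
  "reduced H \<longleftrightarrow> (\<forall>A ps qs. (A, ps) \<in> H \<and> (A, qs) \<in> H \<and> length ps = length qs \<longrightarrow> ps = qs)"

lemma reduced_hair_type:
  assumes "reduced H"
  shows "hair_type H = {(A, length ps) | A ps. (A, ps) \<in> H \<and> ps \<noteq> []}"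
proof -
  have "odd (card {ps. (A, ps) \<in> H \<and> length ps = l}) \<longleftrightarrow> (\<exists>ps. (A, ps) \<in> H \<and> length ps = l)" for A l
  proof (cases "\<exists>ps. (A, ps) \<in> H \<and> length ps = l")
    case True
    then obtain ps where "(A, ps) \<in> H" "length ps = l" by blast
    then have "{ps. (A, ps) \<in> H \<and> length ps = l} = {ps}"
      using assms unfolding reduced_def by blast
    then show ?thesis using True by simp
  next
    case False
    then have "{ps. (A, ps) \<in> H \<and> length ps = l} = {}" by blast
    then have "even (card {ps. (A, ps) \<in> H \<and> length ps = l})" by (simp only: card.empty even_zero)
    then show ?thesis using False by simp
  qed
  then show ?thesis by (auto simp: hair_type_def)
qed

text \<open>Serves twice: in the computation of values it cancels a pair of hairs, and in the
  treatment of simplest form it is the forbidden involution. The latter is why the moved points are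
  described exactly.\<close>

lemma not_reduced_swap:
  assumes C: "finite_simple_graph C" and H: "hair_system C H"
    and ps: "(A, ps) \<in> H" "(A, qs) \<in> H" "length ps = length qs" "ps \<noteq> qs"
  defines "K \<equiv> H - {(A, ps)} - {(A, qs)}"
  obtains \<tau> where "simplicial_involution (attach_hairs C H) \<tau>"
    and "fixed_subgraph (attach_hairs C H) \<tau> = attach_hairs C K"
    and "\<And>v. v \<notin> set ps \<union> set qs \<Longrightarrow> \<tau> v = v"
    and "\<And>v. v \<in> set ps \<union> set qs \<Longrightarrow> \<tau> v \<noteq> v"
    and "hair_system C K" and "hair_type K = hair_type H"
    and "(\<Sum>h\<in>K. length (snd h)) < (\<Sum>h\<in>H. length (snd h))"
proof -
  have qs: "(A, qs) \<in> H - {(A, ps)}" using ps by blast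
  note r = hair_system_remove[OF H ps(1)]
  note s = hair_system_remove[OF r(1) qs, folded K_def]
  have K: "finite_simple_graph (attach_hairs C K)" "A \<in> verts (attach_hairs C K)"
    using finite_simple_attach_hairs[OF C s(1)] r(2) by (simp_all add: verts_attach_hairs)
  have disj: "distinct (qs @ ps)" "set (qs @ ps) \<inter> verts (attach_hairs C K) = {}"
    using r(3,4) s(3,4) unfolding s(5) by auto
  have "hair_type K = hair_type H" unfolding r(6) s(6) using ps(3) by simp
  moreover have "(\<Sum>h\<in>K. length (snd h)) < (\<Sum>h\<in>H. length (snd h))"
  proof -
    have fin: "finite H" using H by (rule hair_system_finite)
    have "0 < length ps" using ps(3,4) by (cases ps) auto
    moreover have "(\<Sum>h\<in>H. length (snd h)) = length ps + (\<Sum>h\<in>H - {(A, ps)}. length (snd h))"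
      using sum.remove[OF fin ps(1), of "\<lambda>h. length (snd h)"] by simp
    moreover have "\<dots> = length ps + (length qs + (\<Sum>h\<in>K. length (snd h)))"
      using sum.remove[OF _ qs, of "\<lambda>h. length (snd h)"] fin by (simp add: K_def)
    ultimately show ?thesis by linarith
  qed
  moreover obtain \<tau> where "simplicial_involution (attach_hairs C H) \<tau>"
    "fixed_subgraph (attach_hairs C H) \<tau> = attach_hairs C K"
    "\<And>v. v \<notin> set ps \<union> set qs \<Longrightarrow> \<tau> v = v" "\<And>v. v \<in> set ps \<union> set qs \<Longrightarrow> \<tau> v \<noteq> v"
    using swap_equal_hairs[OF K disj ps(3)[symmetric]] unfolding r(5) s(5) Un_commute[of "set ps"]
    by blast
  ultimately show thesis using that s(1) by blast
qed

section \<open>Values of the moves on a core with hairs\<close>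

lemma edge_core_new:
  assumes "finite_simple_graph C" "hair_system C H" "h \<in> H" "e \<in> path_edges (fst h # snd h)"
  shows "e \<notin> edges C"
proof
  assume e: "e \<in> edges C"
  obtain A ps where h: "h = (A, ps)" by (cases h)
  obtain qs w rs where "ps = qs @ w # rs" "e = {last (A # qs), w}"
    using assms(4) unfolding h by (auto elim: path_edges_cases)
  then have "w \<in> e" "w \<in> set ps" by auto
  moreover have "set ps \<inter> verts C = {}" using assms(2,3) unfolding h hair_system_def by blast
  ultimately show False using edge_subset_verts[OF assms(1) e] by blast
qed

text \<open>The deletion makes the core bipartite, and hairs keep it so. For weight w the remaining
  graph has w + 1 vertices and w edges modulo 2.\<close>

lemma nim_value_core_edge:
  assumes C: "odd_core C" and H: "hair_system C H" and e: "e \<in> edges C"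
  shows "nim_value (delete_edge (attach_hairs C H) e) =
    (if even (weight (hair_type H)) then 1 else 2)"
proof -
  let ?G = "attach_hairs C H"
  have fin: "finite_simple_graph C" using C by (simp add: odd_core_def)
  note finG = finite_simple_attach_hairs[OF fin H]
  have eG: "e \<in> edges ?G" using e by (simp add: edges_attach_hairs)
  note mv = delete_edge_in_moves[OF eG]
  have "delete_edge ?G e = attach_hairs (delete_edge C e) H"
    using edge_core_new[OF fin H] e by (auto simp: delete_edge_def attach_hairs_def)
  moreover have "hair_system (delete_edge C e) H"
    using H by (simp add: hair_system_def delete_edge_def)
  ultimately have "bipartite (delete_edge ?G e)"
    using C e finite_simple_graph_moves[OF fin delete_edge_in_moves[OF e]]
    by (simp add: bipartite_attach_hairs odd_core_def)
  then have "nim_value (delete_edge ?G e) =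
      of_bool (odd (card (verts ?G))) + 2 * of_bool (even (card (edges ?G)))"
    using nim_value_bipartite[OF finite_simple_graph_moves[OF finG mv]]
      card_edges_delete_edge[OF finG eG] by (simp add: delete_edge_def)
  then show ?thesis
    using attach_hairs_parity(1,2)[OF fin H] C by (auto simp: odd_core_def)
qed

lemma nim_value_core_vertex:
  assumes C: "odd_core C" and H: "hair_system C H" and v: "v \<in> verts C"
  shows "nim_value (delete_vertex (attach_hairs C H) v) = of_bool (odd (weight (hair_type H))) +
    2 * of_bool (odd (weight (hair_type H)) \<longleftrightarrow> odd (hairs_at (hair_type H) v))"
proof -
  let ?G = "attach_hairs C H"
  have fin: "finite_simple_graph C" using C by (simp add: odd_core_def)
  note finG = finite_simple_attach_hairs[OF fin H]
  \<comment> \<open>Deleting \<open>v\<close> removes \<open>e\<close> as well, so bipartiteness is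
    inherited from the graph without \<open>e\<close>.\<close>
  obtain e where e: "e \<in> edges C" "v \<in> e" using C v by (auto simp: odd_core_def)
  have vG: "v \<in> verts ?G" using v by (simp add: verts_attach_hairs)
  note mv = delete_vertex_in_moves[OF vG]
  have "delete_edge ?G e = attach_hairs (delete_edge C e) H"
    using edge_core_new[OF fin H] e by (auto simp: delete_edge_def attach_hairs_def)
  moreover have "hair_system (delete_edge C e) H"
    using H by (simp add: hair_system_def delete_edge_def)
  ultimately have "bipartite (delete_edge ?G e)"
    using C e finite_simple_graph_moves[OF fin delete_edge_in_moves[OF e(1)]]
    by (simp add: bipartite_attach_hairs odd_core_def)
  then have "bipartite (delete_vertex ?G v)"
    by (rule bipartite_subgraph) (use e(2) in \<open>auto simp: delete_edge_def delete_vertex_def\<close>)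
  then have "nim_value (delete_vertex ?G v) =
      of_bool (even (card (verts ?G))) + 2 * of_bool (odd (card (edges ?G) + degree ?G v))"
    using nim_value_bipartite[OF finite_simple_graph_moves[OF finG mv]]
      card_verts_delete_vertex[OF finG vG] card_edges_delete_vertex[OF finG, of v, symmetric]
    by simp
  then show ?thesis
    using attach_hairs_parity[OF fin H] C v by (auto simp: odd_core_def)
qed

text \<open>A cut separates a core with a shorter hair from a path, so the values combine by xor.
  The value \<open>x\<close> of the first part is left open, to be filled in by an induction
  hypothesis.\<close>

lemma nim_value_truncate:
  assumes C: "finite_simple_graph C" and H: "hair_system C H" and h: "(A, qs @ w # rs) \<in> H"
    and tv: "nim_value (attach_hairs C (insert (A, qs) (H - {(A, qs @ w # rs)}))) = x"
  shows "nim_value (delete_vertex (attach_hairs C H) w) = xor x (path_value (length rs))"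
    and "nim_value (delete_edge (attach_hairs C H) {last (A # qs), w}) =
      xor x (path_value (Suc (length rs)))"
proof -
  let ?K = "H - {(A, qs @ w # rs)}"
  note r = hair_system_remove[OF H h]
  have t: "attach_hairs C (insert (A, qs) ?K) = attach (attach_hairs C ?K) A qs"
    by (rule attach_hairs_insert)
  have K: "finite_simple_graph (attach_hairs C ?K)" "A \<in> verts (attach_hairs C ?K)"
    using finite_simple_attach_hairs[OF C r(1)] r(2) by (simp_all add: verts_attach_hairs)
  have fin: "finite_simple_graph (attach (attach_hairs C ?K) A qs)"
    using K r(3,4) by (intro finite_simple_attach) auto
  show "nim_value (delete_vertex (attach_hairs C H) w) = xor x (path_value (length rs))"
    unfolding r(5) delete_vertex_attach[OF K r(3,4)] tv[symmetric] t
    using r(3,4)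
    by (subst nim_value_disjoint_union[OF fin])
      (auto simp: finite_simple_path_graph nim_value_path_graph)
  show "nim_value (delete_edge (attach_hairs C H) {last (A # qs), w}) =
      xor x (path_value (Suc (length rs)))"
    unfolding r(5) delete_edge_attach[OF K r(3,4)] tv[symmetric] t
    using r(3,4)
    by (subst nim_value_disjoint_union[OF fin])
      (auto simp: finite_simple_path_graph nim_value_path_graph)
qed

text \<open>A type does not see moves on hairs that cancel, so graph moves and type moves match only
  for reduced systems. Otherwise a pair of equal hairs is removed by its involution; both cases
  decrease the total length of the hairs.\<close>

theorem nim_value_attach_hairs:
  assumes C: "odd_core C" and H: "hair_system C H"
  shows "nim_value (attach_hairs C H) = type_value (hair_type H)"
  using H
proof (induction "\<Sum>h\<in>H. length (snd h)" arbitrary: H rule: less_induct)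
  case less
  note H = less.prems
  let ?G = "attach_hairs C H" and ?S = "hair_type H"
  have fin: "finite_simple_graph C" using C by (simp add: odd_core_def)
  note finG = finite_simple_attach_hairs[OF fin H]
  show ?case
  proof (cases "reduced H")
    case False
    then obtain A ps qs where ps: "(A, ps) \<in> H" "(A, qs) \<in> H" "length ps = length qs" "ps \<noteq> qs"
      unfolding reduced_def by blast
    obtain \<tau> where \<tau>: "simplicial_involution ?G \<tau>"
      "fixed_subgraph ?G \<tau> = attach_hairs C (H - {(A, ps)} - {(A, qs)})"
      "hair_system C (H - {(A, ps)} - {(A, qs)})" "hair_type (H - {(A, ps)} - {(A, qs)}) = ?S"
      "(\<Sum>h\<in>H - {(A, ps)} - {(A, qs)}. length (snd h)) < (\<Sum>h\<in>H. length (snd h))"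
      using not_reduced_swap[OF fin H ps] by metis
    show ?thesis
      using nim_value_fixed_subgraph[OF finG \<tau>(1)] less.hyps[OF \<tau>(5,3)] \<tau>(2,4) by simp
  next
    case True
    note S = reduced_hair_type[OF True]
    have trunc: "nim_value (delete_vertex ?G w) =
        xor (type_value (toggle (A, length qs) (toggle (A, length ps) ?S))) (path_value (length rs))"
      "nim_value (delete_edge ?G {last (A # qs), w}) =
        xor (type_value (toggle (A, length qs) (toggle (A, length ps) ?S))) (path_value (Suc (length rs)))"
      if "(A, ps) \<in> H" "ps = qs @ w # rs" for A ps qs w rs
    proof -
      have "distinct ps" by (rule hair_system_remove(3)[OF H that(1)])
      then have *: "set qs \<subseteq> set ps" "distinct qs" "length qs < length ps" using that(2) by auto
      note t = hair_system_truncate[OF H that(1) *]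
      have tv: "nim_value (attach_hairs C (insert (A, qs) (H - {(A, ps)}))) =
          type_value (toggle (A, length qs) (toggle (A, length ps) ?S))"
        using less.hyps[OF t(3,1)] unfolding t(2) .
      show "nim_value (delete_vertex ?G w) =
        xor (type_value (toggle (A, length qs) (toggle (A, length ps) ?S))) (path_value (length rs))"
        using nim_value_truncate(1)[OF fin H that(1)[unfolded that(2)] tv[unfolded that(2)]] that(2)
        by simp
      show "nim_value (delete_edge ?G {last (A # qs), w}) =
        xor (type_value (toggle (A, length qs) (toggle (A, length ps) ?S))) (path_value (Suc (length rs)))"
        using nim_value_truncate(2)[OF fin H that(1)[unfolded that(2)] tv[unfolded that(2)]] that(2)
        by simp
    qed
    have inS: "(A, length ps) \<in> ?S" if "(A, ps) \<in> H" "ps = qs @ w # rs" for A ps qs w rs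
    proof -
      have "ps \<noteq> []" using that(2) by simp
      then show ?thesis unfolding S using that(1) by blast
    qed
    have "nim_value ` moves ?G = type_moves (verts C) ?S"
    proof (intro equalityI subsetI)
      fix x assume "x \<in> nim_value ` moves ?G"
      then consider e where "e \<in> edges C" "x = nim_value (delete_edge ?G e)"
        | h e where "h \<in> H" "e \<in> path_edges (fst h # snd h)" "x = nim_value (delete_edge ?G e)"
        | v where "v \<in> verts C" "x = nim_value (delete_vertex ?G v)"
        | h v where "h \<in> H" "v \<in> set (snd h)" "x = nim_value (delete_vertex ?G v)"
        unfolding moves_def verts_attach_hairs edges_attach_hairs by blast
      then show "x \<in> type_moves (verts C) ?S"
      proof cases
        case 1
        then show ?thesis using nim_value_core_edge[OF C H] by (simp add: type_moves_def)
      next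
        case 2
        obtain A ps where h: "h = (A, ps)" by (cases h)
        obtain qs w rs where ps: "ps = qs @ w # rs" "e = {last (A # qs), w}"
          using 2(2) unfolding h by (auto elim: path_edges_cases)
        show ?thesis
          using 2(1,3) unfolding h
          by (intro hair_moveI[OF inS[of A ps qs w rs], of "length qs" "Suc (length rs)"])
            (simp_all add: ps trunc(2)[of A ps qs w rs, unfolded ps(1)] del: last.simps)
      next
        case 3
        then show ?thesis using nim_value_core_vertex[OF C H] vertex_moveI by metis
      next
        case 4
        obtain A ps where h: "h = (A, ps)" by (cases h)
        obtain qs rs where ps: "ps = qs @ v # rs" using 4(2) unfolding h by (auto dest: split_list)
        show ?thesis
          using 4(1,3) unfolding h
          by (intro hair_moveI[OF inS[of A ps qs v rs], of "length qs" "length rs"])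
            (simp_all add: ps trunc(1)[of A ps qs v rs, unfolded ps])
      qed
    next
      fix x assume "x \<in> type_moves (verts C) ?S"
      then show "x \<in> nim_value ` moves ?G"
      proof (cases rule: type_moves_cases)
        case 1
        have "edges C \<noteq> {}" using C by (auto simp: odd_core_def)
        then obtain e where e: "e \<in> edges C" by blast
        then have "e \<in> edges ?G" by (simp add: edges_attach_hairs)
        then show ?thesis
          unfolding 1 nim_value_core_edge[OF C H e, symmetric] by (intro imageI delete_edge_in_moves)
      next
        case (2 A)
        then have "A \<in> verts ?G" by (simp add: verts_attach_hairs)
        then show ?thesis
          unfolding 2(2) nim_value_core_vertex[OF C H 2(1), symmetric]
          by (intro imageI delete_vertex_in_moves)
      next
        case (3 A j l d)
        obtain ps where ps: "(A, ps) \<in> H" "l = length ps" using 3(1) unfolding S by blast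
        \<comment> \<open>The \<open>j\<close> inner vertices are kept and \<open>w\<close> is the
          first one lost. Deleting the edge before \<open>w\<close> splits off \<open>l - j\<close>
          vertices, deleting \<open>w\<close> itself one less; these are the two choices of
          \<open>d\<close>.\<close>
        define qs w rs where "qs = take j ps" and "w = ps ! j" and "rs = drop (Suc j) ps"
        have split: "ps = qs @ w # rs"
          unfolding qs_def w_def rs_def using 3(2) ps(2) by (simp add: id_take_nth_drop)
        have len: "length qs = j" "length rs = l - Suc j"
          unfolding qs_def rs_def using 3(2) ps(2) by auto
        have w: "w \<in> verts ?G" using ps(1) split by (force simp: verts_attach_hairs)
        have "{last (A # qs), w} \<in> path_edges (A # ps)"
          unfolding split using path_edges_append[of A qs w rs] by simp
        then have e: "{last (A # qs), w} \<in> edges ?G"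
          using ps(1) by (force simp: edges_attach_hairs)
        show ?thesis
        proof (cases "d = l - j")
          case True
          then have "d = Suc (length rs)" using len 3(2) by simp
          then have "x = nim_value (delete_edge ?G {last (A # qs), w})"
            unfolding trunc(2)[OF ps(1) split] using 3(4) len ps(2) by simp
          then show ?thesis using delete_edge_in_moves[OF e] by blast
        next
          case False
          then have "d = length rs" using len 3(2,3) by simp
          then have "x = nim_value (delete_vertex ?G w)"
            unfolding trunc(1)[OF ps(1) split] using 3(4) len ps(2) by simp
          then show ?thesis using delete_vertex_in_moves[OF w] by blast
        qed
      qed
    qed
    then have "nim_value ?G = mex (type_moves (verts C) ?S)"
      using nim_value_mex[OF finG] by simp
    also have "\<dots> = type_value ?S"
      using hair_type_properties[OF H] C
      by (intro mex_type_moves) (auto simp: odd_core_def finite_simple_graph_def)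
    finally show ?thesis .
  qed
qed

subsection \<open>Structure of hairballs\<close>

lemma edges_cycle_graph:
  "edges (cycle_graph xs) = (\<lambda>i. {xs ! i, xs ! (Suc i mod length xs)}) ` {..<length xs}"
  by (auto simp: cycle_graph_def)

lemma verts_cycle_graph [simp]: "verts (cycle_graph xs) = set xs"
  by (simp add: cycle_graph_def)

lemma edges_cycle_graph_Cons:
  "edges (cycle_graph (x # xs)) = insert {last (x # xs), x} (path_edges (x # xs))"
proof -
  let ?n = "length xs"
  have "{..<length (x # xs)} = insert ?n {..<?n}" by auto
  then have "edges (cycle_graph (x # xs)) = insert {(x # xs) ! ?n, (x # xs) ! 0}
      ((\<lambda>i. {(x # xs) ! i, (x # xs) ! Suc i}) ` {..<?n})"
    unfolding edges_cycle_graph by simp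
  then show ?thesis by (auto simp: path_edges_def last_conv_nth)
qed

lemma odd_core_cycle_graph:
  assumes xs: "distinct xs" "3 \<le> length xs" "odd (length xs)"
  shows "odd_core (cycle_graph xs)"
proof -
  let ?n = "length xs" and ?C = "cycle_graph xs"
  \<comment> \<open>The cyclic successor of an index, with the wrap-around as a case distinction
    instead of \<open>mod\<close>.\<close>
  define s where "s i = (if Suc i = ?n then 0 else Suc i)" for i
  define edge where "edge i = {xs ! i, xs ! s i}" for i
  have s: "s i < ?n" "s i \<noteq> i" "s (s i) \<noteq> i" if "i < ?n" for i
    using that xs(2) by (auto simp: s_def)
  have eq: "xs ! i = xs ! j \<longleftrightarrow> i = j" if "i < ?n" "j < ?n" for i j
    using that xs(1) by (simp add: nth_eq_iff_index_eq)
  have E: "edges ?C = edge ` {..<?n}"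
    unfolding edges_cycle_graph edge_def s_def
    by (intro image_cong refl) (auto simp: Suc_lessI mod_Suc)
  \<comment> \<open>Two indices with the same edge would be successors of each other, which a length
    of at least 3 excludes.\<close>
  have inj: "inj_on edge {..<?n}"
  proof (rule inj_onI)
    fix i j assume ij: "i \<in> {..<?n}" "j \<in> {..<?n}" "edge i = edge j"
    then have "i = j \<or> (i = s j \<and> s i = j)"
      using s(1)[of i] s(1)[of j] by (auto simp: edge_def doubleton_eq_iff eq)
    then show "i = j" using s(3)[of j] ij by auto
  qed
  have cardE: "card (edges ?C) = ?n" unfolding E by (simp add: card_image[OF inj])
  have fin: "finite_simple_graph ?C"
  proof -
    have "card (edge i) = 2" if "i < ?n" for i
      using eq[OF that s(1)[OF that]] s(2)[OF that] by (auto simp: edge_def card_2_iff)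
    then show ?thesis using s(1) unfolding finite_simple_graph_def E by (auto simp: edge_def)
  qed
  have deg: "degree ?C v = 2" if v: "v \<in> set xs" for v
  proof -
    obtain k where k: "k < ?n" "v = xs ! k" using v by (auto simp: in_set_conv_nth)
    define p where "p = (if k = 0 then ?n - 1 else k - 1)"
    have p: "p < ?n" "p \<noteq> k" "s p = k" using k xs(2) by (auto simp: p_def s_def)
    have sk: "s i = k \<longleftrightarrow> i = p" if "i < ?n" for i
      using that k xs(2) by (auto simp: p_def s_def)
    have "v \<in> edge i \<longleftrightarrow> i = k \<or> i = p" if "i < ?n" for i
      using that s(1)[OF that] k sk[OF that] by (auto simp: edge_def eq)
    then have "{e \<in> edges ?C. v \<in> e} = edge ` {k, p}"
      unfolding E using k p by auto
    moreover have "inj_on edge {k, p}" using k p by (intro inj_on_subset[OF inj]) auto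
    ultimately show ?thesis using p(2) by (simp add: degree_def card_image)
  qed
  have "bipartite (delete_edge ?C e)" if e: "e \<in> edges ?C" for e
  proof -
    obtain k where k: "k < ?n" "e = edge k" using e unfolding E by auto
    \<comment> \<open>Colours alternate along the indices and are exchanged after \<open>k\<close>,
      so the only edge between consecutive indices that may be badly coloured is the deleted one. As
      the length is odd, this one exchange also gives the ends of the closing edge different
      colours.\<close>
    define L where "L = (\<lambda>j. xs ! j) ` {j. j < ?n \<and> (even j \<longleftrightarrow> j \<le> k)}"
    have L: "xs ! j \<in> L \<longleftrightarrow> (even j \<longleftrightarrow> j \<le> k)" if "j < ?n" for j
      using that eq by (auto simp: L_def)
    have "card (edge i \<inter> L) = 1" if i: "i < ?n" "i \<noteq> k" for i
    proof -
      have "(even (s i) \<longleftrightarrow> s i \<le> k) \<longleftrightarrow> \<not> (even i \<longleftrightarrow> i \<le> k)"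
      proof (cases "Suc i = ?n")
        case True
        then have "even i" using xs(3) by (metis even_Suc)
        moreover have "k < i" using True k(1) i by simp
        ultimately show ?thesis using True by (simp add: s_def)
      qed (use i in \<open>auto simp: s_def\<close>)
      then have "xs ! s i \<in> L \<longleftrightarrow> xs ! i \<notin> L" using L i s(1) by simp
      then have "edge i \<inter> L = {xs ! i} \<or> edge i \<inter> L = {xs ! s i}"
        unfolding edge_def by auto
      then show ?thesis by auto
    qed
    then have "\<forall>f \<in> edges (delete_edge ?C e). card (f \<inter> L) = 1"
      unfolding delete_edge_def E k(2) by auto
    then show ?thesis unfolding bipartite_def by blast
  qed
  moreover have "\<exists>e\<in>edges ?C. v \<in> e" if "v \<in> set xs" for v
  proof -
    have "{e \<in> edges ?C. v \<in> e} \<noteq> {}"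
    proof
      assume "{e \<in> edges ?C. v \<in> e} = {}"
      then show False using deg[OF that] unfolding degree_def by (simp only: card.empty)
    qed
    then show ?thesis by blast
  qed
  ultimately show ?thesis
    unfolding odd_core_def using fin deg cardE xs by (simp add: distinct_card)
qed

section \<open>Connectedness and closing a cycle\<close>

definition adjacent :: "'a graph \<Rightarrow> ('a \<times> 'a) set" where
  "adjacent G = {(u, v). {u, v} \<in> edges G}"

lemma sym_adjacent_rtrancl: "(x, y) \<in> (adjacent G)\<^sup>* \<Longrightarrow> (y, x) \<in> (adjacent G)\<^sup>*"
  by (rule symD[OF sym_rtrancl]) (auto intro!: symI simp: adjacent_def insert_commute)

lemma connected_graph_adjacent:
  "connected_graph G \<longleftrightarrow> verts G \<noteq> {} \<and> (\<forall>x \<in> verts G. \<forall>y \<in> verts G. (x, y) \<in> (adjacent G)\<^sup>*)"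
  by (simp add: connected_graph_def adjacent_def)

lemma connected_graphI:
  assumes "u \<in> verts G" "\<And>x. x \<in> verts G \<Longrightarrow> (u, x) \<in> (adjacent G)\<^sup>*"
  shows "connected_graph G"
  using assms sym_adjacent_rtrancl unfolding connected_graph_adjacent
  by (metis empty_iff rtrancl_trans)

lemma connected_pendant:
  assumes "connected_graph K" "u \<in> verts K"
  shows "connected_graph (pendant K u w)"
proof (rule connected_graphI)
  show "u \<in> verts (pendant K u w)" using assms(2) by (simp add: pendant_def)
  fix x assume x: "x \<in> verts (pendant K u w)"
  show "(u, x) \<in> (adjacent (pendant K u w))\<^sup>*"
  proof (cases "x \<in> verts K")
    case True
    then have "(u, x) \<in> (adjacent K)\<^sup>*" using assms by (simp add: connected_graph_adjacent)
    moreover have "adjacent K \<subseteq> adjacent (pendant K u w)"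
      by (auto simp: adjacent_def pendant_def)
    ultimately show ?thesis using rtrancl_mono by blast
  next
    case False
    then have "(u, x) \<in> adjacent (pendant K u w)" using x by (auto simp: adjacent_def pendant_def)
    then show ?thesis by blast
  qed
qed

lemma connected_attach_hairs:
  assumes "connected_graph C" "hair_system C H"
  shows "connected_graph (attach_hairs C H)"
  using assms(2)
proof (induction rule: hair_system_induct)
  case (insert A ps H)
  have "A \<in> verts (attach_hairs C H)" using insert by (simp add: verts_attach_hairs)
  then show ?case
    unfolding attach_hairs_insert using insert(4,5)
    by (induction rule: attach_induct) (simp_all add: insert.IH connected_pendant)
qed (simp add: assms(1))

lemma connected_cycle_graph:
  assumes "xs \<noteq> []"
  shows "connected_graph (cycle_graph xs)"
proof (rule connected_graphI)
  show "xs ! 0 \<in> verts (cycle_graph xs)" using assms by simp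
  fix x assume "x \<in> verts (cycle_graph xs)"
  then obtain i where "i < length xs" "x = xs ! i" by (auto simp: in_set_conv_nth)
  moreover have "(xs ! 0, xs ! i) \<in> (adjacent (cycle_graph xs))\<^sup>*" if "i < length xs" for i
    using that
  proof (induction i)
    case (Suc i)
    have "(xs ! i, xs ! Suc i) \<in> adjacent (cycle_graph xs)"
      unfolding adjacent_def edges_cycle_graph using Suc.prems by (auto intro!: image_eqI[of _ _ i])
    then show ?case using Suc by (meson Suc_lessD rtrancl.rtrancl_into_rtrancl)
  qed simp
  ultimately show "(xs ! 0, x) \<in> (adjacent (cycle_graph xs))\<^sup>*" by blast
qed

text \<open>A walk is kept simple while it grows: when its next vertex already occurs, the path is
  cut back to that vertex.\<close>

lemma rtrancl_adjacent_path:
  assumes "(x, y) \<in> (adjacent K)\<^sup>*"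
  obtains zs where "distinct (x # zs)" "last (x # zs) = y" "path_edges (x # zs) \<subseteq> edges K"
proof -
  have "\<exists>zs. distinct (x # zs) \<and> last (x # zs) = y \<and> path_edges (x # zs) \<subseteq> edges K"
    using assms
  proof (induction rule: rtrancl_induct)
    case base
    show ?case by (intro exI[of _ "[]"]) simp
  next
    case (step y z)
    then obtain zs where zs: "distinct (x # zs)" "last (x # zs) = y" "path_edges (x # zs) \<subseteq> edges K"
      by blast
    consider "z = x" | "z \<in> set zs" | "z \<notin> set (x # zs)" by auto
    then show ?case
    proof cases
      case 1
      then show ?thesis by (intro exI[of _ "[]"]) simp
    next
      case 2
      then obtain as bs where ab: "zs = as @ z # bs" by (auto dest: split_list)
      have "path_edges (x # as @ [z]) \<subseteq> path_edges (x # zs)"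
        unfolding ab using path_edges_append[of x as z bs] path_edges_append[of x as z "[]"] by auto
      then show ?thesis using zs ab by (intro exI[of _ "as @ [z]"]) auto
    next
      case 3
      then have "path_edges (x # zs @ [z]) \<subseteq> edges K"
        using path_edges_snoc[of x zs z] zs step.hyps(2) by (simp add: adjacent_def)
      then show ?thesis using 3 zs(1) by (intro exI[of _ "zs @ [z]"]) auto
    qed
  qed
  then show thesis using that by blast
qed

text \<open>A path in \<open>K\<close> between the ends of the edge, together with the edge, forms a
  cycle. It has at least three vertices because the edge is not in \<open>K\<close> and so is not
  the path itself.\<close>

lemma edge_closes_cycle:
  assumes G: "finite_simple_graph G" and K: "connected_graph K" "subgraph K G"
    and xy: "x \<in> verts K" "y \<in> verts K" "{x, y} \<in> edges G" "{x, y} \<notin> edges K"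
  obtains C where "C \<in> cycles G" "{x, y} \<in> edges C"
proof -
  have "(x, y) \<in> (adjacent K)\<^sup>*" using K(1) xy(1,2) by (simp add: connected_graph_adjacent)
  then obtain zs where zs: "distinct (x # zs)" "last (x # zs) = y" "path_edges (x # zs) \<subseteq> edges K"
    by (rule rtrancl_adjacent_path)
  have "x \<noteq> y" using G xy(3) by (auto simp: finite_simple_graph_def)
  then have "zs \<noteq> []" using zs(2) by auto
  moreover have "length zs \<noteq> 1"
  proof
    assume "length zs = 1"
    then have "zs = [y]" using zs(2) by (cases zs) auto
    then have "{x, y} \<in> path_edges (x # zs)" using path_edges_append[of x "[]" y "[]"] by simp
    then show False using zs(3) xy(4) by blast
  qed
  ultimately have len: "3 \<le> length (x # zs)" by (cases zs rule: list.exhaust; cases "tl zs") auto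
  have E: "edges (cycle_graph (x # zs)) = insert {x, y} (path_edges (x # zs))"
    unfolding edges_cycle_graph_Cons zs(2) by (simp add: insert_commute)
  have EG: "edges (cycle_graph (x # zs)) \<subseteq> edges G"
    unfolding E using zs(3) K(2) xy(3) by (auto simp: subgraph_def)
  have "v \<in> verts G" if v: "v \<in> set (x # zs)" for v
  proof -
    obtain i where i: "i < length (x # zs)" "v = (x # zs) ! i" using v by (auto simp only: in_set_conv_nth)
    then have "\<exists>e\<in>edges (cycle_graph (x # zs)). v \<in> e" unfolding edges_cycle_graph by blast
    then show ?thesis using EG edge_subset_verts[OF G] by blast
  qed
  then have "subgraph (cycle_graph (x # zs)) G" using EG unfolding subgraph_def verts_cycle_graph by blast
  then have "cycle_graph (x # zs) \<in> cycles G" unfolding cycles_def using zs(1) len by blast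
  then show thesis using that E by blast
qed

section \<open>Decomposition of a hairball into its cycle and hairs\<close>

lemma cycle_of_in_cycles:
  assumes "pseudotree G"
  shows "cycle_of G \<in> cycles G" and "C \<in> cycles G \<Longrightarrow> C = cycle_of G"
  using assms unfolding pseudotree_def cycle_of_def by (auto intro: theI' the1_equality[symmetric])

lemma rtrancl_exit:
  assumes "(a, b) \<in> r\<^sup>*" "a \<in> S" "b \<notin> S"
  obtains u v where "(u, v) \<in> r" "u \<in> S" "v \<notin> S"
  using assms by (induction rule: rtrancl_induct) blast+

text \<open>From a vertex of the cycle the new edge starts a hair; from a vertex on a hair it
  prolongs that hair, whose end it must then be.\<close>

lemma hair_system_extend:
  assumes G: "hairball G" and H: "hair_system (cycle_of G) H"
    and sub: "subgraph (attach_hairs (cycle_of G) H) G"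
    and uv: "{u, v} \<in> edges G" "u \<in> verts (attach_hairs (cycle_of G) H)"
      "v \<notin> verts (attach_hairs (cycle_of G) H)"
  obtains H' where "hair_system (cycle_of G) H'" "subgraph (attach_hairs (cycle_of G) H') G"
    "verts (attach_hairs (cycle_of G) H') = insert v (verts (attach_hairs (cycle_of G) H))"
proof -
  let ?C = "cycle_of G"
  let ?R = "attach_hairs ?C H"
  have fin: "finite_simple_graph G" using G by (simp add: hairball_def pseudotree_def)
  have vG: "v \<in> verts G" using edge_subset_verts[OF fin uv(1)] by simp
  have pend: "subgraph (pendant ?R u v) G"
    using sub vG uv(1) by (auto simp: subgraph_def pendant_def)
  have vp: "verts (pendant ?R u v) = insert v (verts ?R)" by (simp add: pendant_def)
  show thesis
  proof (cases "u \<in> verts ?C")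
    case True
    have new: "(u, [v]) \<notin> H" using uv(3) by (force simp: verts_attach_hairs)
    have "attach_hairs ?C (insert (u, [v]) H) = pendant ?R u v"
      unfolding attach_hairs_insert using attach_snoc[of ?R u "[]" v] by simp
    moreover have "hair_system ?C (insert (u, [v]) H)"
      unfolding hair_system_insert[OF new] using H True uv(3) by simp
    ultimately show thesis using that[of "insert (u, [v]) H"] pend vp by simp
  next
    case False
    then obtain A ps where h: "(A, ps) \<in> H" "u \<in> set ps" using uv(2) by (auto simp: verts_attach_hairs)
    let ?K = "H - {(A, ps)}"
    note r = hair_system_remove[OF H h(1)]
    obtain qs rs where ps: "ps = qs @ u # rs" using h(2) by (auto dest: split_list)
    \<comment> \<open>Otherwise \<open>u\<close>, which is off the cycle, would have the new edge
      besides its two edges along the hair, contrary to the degree bound.\<close>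
    have "rs = []"
    proof (rule ccontr)
      assume "rs \<noteq> []"
      then obtain w ws where rs: "rs = w # ws" by (cases rs) auto
      let ?l = "last (A # qs)"
      have l: "?l \<in> insert A (set qs)" by (cases qs) auto
      have path: "path_edges (A # ps) \<subseteq> edges G"
        using sub h(1) by (force simp: subgraph_def edges_attach_hairs)
      have "{?l, u} \<in> edges G" "{u, w} \<in> edges G"
        using path path_edges_append[of A qs u rs] path_edges_append[of u "[]" w ws]
        unfolding ps rs by auto
      then have three: "{{?l, u}, {u, w}, {u, v}} \<subseteq> {e \<in> edges G. u \<in> e}" using uv(1) by blast
      have R: "insert A (set ps) \<subseteq> verts ?R" using h(1) r(2) by (force simp: verts_attach_hairs)
      have "A \<notin> set ps" using r(2,4) by (auto simp: verts_attach_hairs)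
      then have "?l \<noteq> w" using l r(3) unfolding ps rs by auto
      moreover have "v \<noteq> w" "v \<noteq> ?l" using uv(3) R l unfolding ps rs by auto
      moreover have "?l \<noteq> u" using l r(3) \<open>A \<notin> set ps\<close> unfolding ps by auto
      ultimately have "card {{?l, u}, {u, w}, {u, v}} = 3"
        by (simp add: doubleton_eq_iff del: last.simps)
      then have "3 \<le> degree G u"
        unfolding degree_def using card_mono[OF _ three] finite_edges[OF fin] by simp
      moreover have "u \<in> verts G" using uv(2) sub by (auto simp: subgraph_def)
      ultimately show False using G False unfolding hairball_def by (metis DiffI Suc_n_not_le_n eval_nat_numeral(3) le_trans)
    qed
    then have last: "last (A # ps) = u" by (simp add: ps)
    have R: "?R = attach (attach_hairs ?C ?K) A ps" by (rule r(5))
    have new: "(A, ps @ [v]) \<notin> ?K" using uv(3) by (force simp: verts_attach_hairs)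
    have "attach_hairs ?C (insert (A, ps @ [v]) ?K) = pendant ?R u v"
      unfolding attach_hairs_insert attach_snoc last R ..
    moreover have "hair_system ?C (insert (A, ps @ [v]) ?K)"
      unfolding hair_system_insert[OF new] using r(1-4) uv(3) unfolding R by auto
    ultimately show thesis using that[of "insert (A, ps @ [v]) ?K"] pend vp by simp
  qed
qed

text \<open>Take a hair system inside \<open>G\<close> whose graph has the most vertices. By
  connectedness an uncovered vertex would allow an extension. An uncovered edge would then lie on a
  cycle other than the unique one.\<close>

theorem hairball_decomposition:
  assumes G: "hairball G"
  obtains H where "hair_system (cycle_of G) H" "G = attach_hairs (cycle_of G) H"
proof -
  let ?C = "cycle_of G"
  have pt: "pseudotree G" and fin: "finite_simple_graph G" and conn: "connected_graph G"
    using G by (auto simp: hairball_def pseudotree_def)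
  note C = cycle_of_in_cycles[OF pt]
  obtain xs where xs: "distinct xs" "3 \<le> length xs" "?C = cycle_graph xs" "subgraph ?C G"
    using C(1) unfolding cycles_def by blast
  let ?P = "\<lambda>H. hair_system ?C H \<and> subgraph (attach_hairs ?C H) G"
  let ?f = "\<lambda>H. card (verts (attach_hairs ?C H))"
  have finV: "finite (verts G)" using fin by (simp add: finite_simple_graph_def)
  have "?P {}" using xs(4) by (simp add: hair_system_def)
  moreover have "\<forall>H. ?P H \<longrightarrow> ?f H < Suc (card (verts G))"
    using finV by (auto simp: subgraph_def less_Suc_eq_le intro: card_mono)
  ultimately obtain H where H: "?P H" and max: "\<And>H'. ?P H' \<Longrightarrow> ?f H' \<le> ?f H"
    using ex_has_greatest_nat[of ?P "{}" ?f] by blast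
  let ?R = "attach_hairs ?C H"
  have sub: "verts ?R \<subseteq> verts G" "edges ?R \<subseteq> edges G" using H by (auto simp: subgraph_def)
  have V: "verts ?R = verts G"
  proof (rule ccontr)
    assume "verts ?R \<noteq> verts G"
    then obtain w where w: "w \<in> verts G" "w \<notin> verts ?R" using sub by blast
    have "xs ! 0 \<in> set xs" using xs(2) by (intro nth_mem) auto
    then have "xs ! 0 \<in> verts ?R" using xs(3) by (simp add: verts_attach_hairs)
    then have c: "xs ! 0 \<in> verts ?R" "xs ! 0 \<in> verts G" using sub by auto
    then have "(xs ! 0, w) \<in> (adjacent G)\<^sup>*" using conn w by (simp add: connected_graph_adjacent)
    then obtain u v where uv: "{u, v} \<in> edges G" "u \<in> verts ?R" "v \<notin> verts ?R"
      using rtrancl_exit[of _ w "adjacent G" "verts ?R"] c(1) w(2) by (auto simp: adjacent_def)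
    obtain H' where H': "?P H'" "verts (attach_hairs ?C H') = insert v (verts ?R)"
      using hair_system_extend[OF G _ _ uv] H by blast
    have "?f H' = Suc (?f H)"
      unfolding H'(2) using uv(3) finite_subset[OF sub(1) finV] by simp
    then show False using max[OF H'(1)] by simp
  qed
  have connR: "connected_graph ?R"
    using connected_attach_hairs[of ?C H] connected_cycle_graph[of xs] xs H by force
  have "e \<in> edges ?R" if e: "e \<in> edges G" for e
  proof (rule ccontr)
    assume new: "e \<notin> edges ?R"
    obtain x y where xy: "e = {x, y}"
      using e fin by (auto simp: finite_simple_graph_def card_2_iff)
    have "x \<in> verts ?R" "y \<in> verts ?R" using edge_subset_verts[OF fin e] V xy by auto
    then obtain D where "D \<in> cycles G" "e \<in> edges D"
      using edge_closes_cycle[OF fin connR, of x y] H e new unfolding xy by blast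
    then have "e \<in> edges ?C" using C(2) by blast
    then show False using new by (simp add: edges_attach_hairs)
  qed
  then have "G = ?R" using V sub by (intro graph.expand) auto
  then show thesis using that H by blast
qed

section \<open>Simplest form and pairs of consecutive hairs\<close>

lemma simplest_form_reduced:
  assumes C: "finite_simple_graph C" and H: "hair_system C H"
    and simplest: "simplest_form (attach_hairs C H)"
  shows "reduced H"
proof (rule ccontr)
  let ?G = "attach_hairs C H"
  assume "\<not> reduced H"
  then obtain A ps qs where ps: "(A, ps) \<in> H" "(A, qs) \<in> H" "length ps = length qs" "ps \<noteq> qs"
    unfolding reduced_def by blast
  obtain \<tau> where \<tau>: "simplicial_involution ?G \<tau>"
    "\<And>v. v \<notin> set ps \<union> set qs \<Longrightarrow> \<tau> v = v" "\<And>v. v \<in> set ps \<union> set qs \<Longrightarrow> \<tau> v \<noteq> v"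
    using not_reduced_swap[OF C H ps] by metis
  have inv: "\<tau> (\<tau> v) = v" for v using \<tau>(1) unfolding simplicial_involution_def by blast
  have te: "\<tau> ` e \<in> edges ?G" if "e \<in> edges ?G" for e
    using that \<tau>(1) unfolding simplicial_involution_def by blast
  have noflip: "\<tau> v = v" if "e \<in> edges ?G" "\<tau> ` e = e" "v \<in> e" for e v
    using that \<tau>(1) unfolding simplicial_involution_def by blast
  have fin: "finite_simple_graph ?G" by (rule finite_simple_attach_hairs[OF C H])
  have sub: "set ps \<union> set qs \<subseteq> verts ?G" using ps(1,2) by (force simp: verts_attach_hairs)
  have "involution ?G \<tau>"
    unfolding involution_def
  proof (intro conjI ballI)
    \<comment> \<open>Being a permutation of the vertices includes fixing every point outside, which
      holds as \<tau> moves hair vertices only.\<close>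
    show "\<tau> permutes verts ?G"
      unfolding permutes_def using inv \<tau>(2) sub by (metis subsetD)
    show "\<tau> \<circ> \<tau> = id" using inv by auto
    fix x y
    show "{x, y} \<in> edges ?G \<longleftrightarrow> {\<tau> x, \<tau> y} \<in> edges ?G"
      using te[of "{x, y}"] te[of "{\<tau> x, \<tau> y}"] by (auto simp: inv)
  qed
  moreover have "\<tau> \<noteq> id"
  proof -
    obtain v where "v \<in> set ps \<union> set qs" using ps(3,4) by (cases ps) auto
    then show ?thesis using \<tau>(3)[of v] by auto
  qed
  moreover have "\<not> (\<tau> x = y \<and> \<tau> y = x)" if e: "{x, y} \<in> edges ?G" for x y
  proof
    assume xy: "\<tau> x = y \<and> \<tau> y = x"
    then have "\<tau> ` {x, y} = {x, y}" by auto
    then have "\<tau> x = x" using noflip[OF e] by blast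
    then have "x = y" using xy by simp
    then show False using fin e by (auto simp: finite_simple_graph_def)
  qed
  ultimately show False using simplest unfolding simplest_form_def by blast
qed

lemma two_consecutive_hairs_decomposition:
  assumes "two_consecutive_hairs G"
  obtains H where "hair_system (cycle_of G) H" "G = attach_hairs (cycle_of G) H"
    "consecutive (hair_type H)"
proof -
  let ?C = "cycle_of G"
  obtain A ps qs where A: "A \<in> verts ?C" "length qs = length ps + 1" "distinct (ps @ qs)"
    "set (ps @ qs) \<inter> verts ?C = {}" "verts G = verts ?C \<union> set ps \<union> set qs"
    "edges G = edges ?C \<union> path_edges (A # ps) \<union> path_edges (A # qs)"
    using assms unfolding two_consecutive_hairs_def by blast
  \<comment> \<open>For \<open>k = 0\<close> this contains the empty hair at \<open>A\<close>, which
    neither the graph nor the type notices.\<close>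
  let ?H = "{(A, ps), (A, qs)}"
  have ne: "(A, ps) \<notin> {(A, qs)}" using A(2) by auto
  have "hair_system ?C ?H" using A(1,3,4) by (auto simp: hair_system_def)
  moreover have "G = attach_hairs ?C ?H"
    using A(5,6) by (intro graph.expand) (auto simp: attach_hairs_def)
  moreover have "hair_type ?H = toggle (A, length ps) (toggle (A, Suc (length ps)) {})"
    using hair_type_insert[OF _ ne] hair_type_insert[of "{}" A qs] A(2) by simp
  then have "consecutive (hair_type ?H)"
    by (auto simp: consecutive_def toggle_def)
  ultimately show thesis using that by blast
qed

lemma consecutive_two_consecutive_hairs:
  assumes H: "hair_system (cycle_of G) H" and G: "G = attach_hairs (cycle_of G) H"
    and red: "reduced H" and con: "consecutive (hair_type H)"
  shows "two_consecutive_hairs G"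
proof -
  let ?C = "cycle_of G"
  obtain A k where Ak: "hair_type H = toggle (A, k) {(A, Suc k)}"
    using con by (auto simp: consecutive_def)
  note S = reduced_hair_type[OF red]
  have "(A, Suc k) \<in> hair_type H" unfolding Ak by (simp add: toggle_def)
  then obtain qs where qs: "(A, qs) \<in> H" "length qs = Suc k" unfolding S by auto
  \<comment> \<open>For \<open>k = 0\<close> the shorter path is empty and need not occur in
    \<open>H\<close>.\<close>
  obtain ps where ps: "ps = [] \<or> (A, ps) \<in> H" "length ps = k"
  proof (cases "k = 0")
    case False
    then have "(A, k) \<in> hair_type H" unfolding Ak by (simp add: toggle_def)
    then obtain ps where "(A, ps) \<in> H" "length ps = k" unfolding S by auto
    then show thesis using that by blast
  qed (use that[of "[]"] in auto)
  \<comment> \<open>A pair in the type determines a single hair because \<open>H\<close> is reduced,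
    so besides empty hairs only \<open>ps\<close> and \<open>qs\<close> remain.\<close>
  have all: "rs = [] \<or> B = A \<and> (rs = ps \<or> rs = qs)" if h: "(B, rs) \<in> H" for B rs
  proof (cases "rs = []")
    case False
    then have "(B, length rs) \<in> hair_type H" unfolding S using h by blast
    then have BA: "B = A" and len: "length rs = k \<or> length rs = Suc k"
      unfolding Ak by (auto simp: toggle_def split: if_splits)
    from len show ?thesis
    proof
      assume k: "length rs = k"
      then have "(A, ps) \<in> H" using ps False by auto
      then have "rs = ps" using red h k ps(2) unfolding BA reduced_def by blast
      then show ?thesis using BA by blast
    next
      assume "length rs = Suc k"
      then have "rs = qs" using red h qs unfolding BA reduced_def by metis
      then show ?thesis using BA by blast
    qed
  qed simp
  have 1: "A \<in> verts ?C" "distinct qs" "set qs \<inter> verts ?C = {}"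
    using H qs(1) by (auto simp: hair_system_def)
  have 2: "distinct ps" "set ps \<inter> verts ?C = {}" using H ps(1) by (auto simp: hair_system_def)
  have 3: "set ps \<inter> set qs = {}"
  proof (cases "ps = []")
    case False
    then have "(A, ps) \<in> H" "(A, ps) \<noteq> (A, qs)" using ps qs by auto
    moreover have "\<forall>h\<in>H. \<forall>h'\<in>H. h \<noteq> h' \<longrightarrow> set (snd h) \<inter> set (snd h') = {}"
      using H by (simp add: hair_system_def)
    ultimately have "set (snd (A, ps)) \<inter> set (snd (A, qs)) = {}" using qs(1) by blast
    then show ?thesis by simp
  qed simp
  have "verts G = verts ?C \<union> (\<Union>h\<in>H. set (snd h))"
    using verts_attach_hairs[of ?C H] G by metis
  also have "\<dots> = verts ?C \<union> set ps \<union> set qs" using all ps(1) qs(1) by fastforce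
  finally have V: "verts G = verts ?C \<union> set ps \<union> set qs" .
  have "edges G = edges ?C \<union> (\<Union>h\<in>H. path_edges (fst h # snd h))"
    using edges_attach_hairs[of ?C H] G by metis
  also have "(\<Union>h\<in>H. path_edges (fst h # snd h)) = path_edges (A # ps) \<union> path_edges (A # qs)"
  proof (intro equalityI subsetI)
    fix e assume "e \<in> (\<Union>h\<in>H. path_edges (fst h # snd h))"
    then obtain B rs where "(B, rs) \<in> H" "e \<in> path_edges (B # rs)" by auto
    then show "e \<in> path_edges (A # ps) \<union> path_edges (A # qs)" using all[of B rs] by auto
  next
    fix e assume "e \<in> path_edges (A # ps) \<union> path_edges (A # qs)"
    then show "e \<in> (\<Union>h\<in>H. path_edges (fst h # snd h))" using ps(1) qs(1) by force
  qed
  finally have E: "edges G = edges ?C \<union> path_edges (A # ps) \<union> path_edges (A # qs)" by blast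
  show ?thesis
    unfolding two_consecutive_hairs_def
    using 1 2 3 V E ps(2) qs(2)
    by (intro exI[of _ A] exI[of _ k] exI[of _ ps] exI[of _ qs]) auto
qed

theorem theorem6:
  fixes G :: "'a graph"
  assumes "hairball G"
    and "odd (card (verts (cycle_of G)))"
    and "simplest_form G"
    and "G \<noteq> cycle_of G"
  shows "(even (card (verts G)) \<and> two_consecutive_hairs G \<longrightarrow> nim_value G = 4) \<and>
         (even (card (verts G)) \<and> \<not> two_consecutive_hairs G \<longrightarrow> nim_value G = 0) \<and>
         (odd (card (verts G)) \<longrightarrow> nim_value G = 3)"
proof -
  let ?C = "cycle_of G"
  have "pseudotree G" using assms(1) by (simp add: hairball_def)
  then obtain xs where xs: "distinct xs" "3 \<le> length xs" "?C = cycle_graph xs"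
    using cycle_of_in_cycles(1) unfolding cycles_def by blast
  have core: "odd_core ?C"
    using odd_core_cycle_graph[OF xs(1,2)] assms(2) xs by (simp add: distinct_card)
  have fin: "finite_simple_graph ?C" using core by (simp add: odd_core_def)
  \<comment> \<open>Stated for every decomposition of \<open>G\<close>, since one more besides
    \<open>H\<close> is used below.\<close>
  have nim: "nim_value G = type_value (hair_type H)"
    and parity: "even (card (verts G)) \<longleftrightarrow> odd (weight (hair_type H))"
    if "hair_system ?C H" "G = attach_hairs ?C H" for H
    using nim_value_attach_hairs[OF core that(1)] attach_hairs_parity(1)[OF fin that(1)]
      that(2)[symmetric] assms(2) by auto
  obtain H where H: "hair_system ?C H" "G = attach_hairs ?C H"
    using hairball_decomposition[OF assms(1)] by blast
  have red: "reduced H"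
    using simplest_form_reduced[OF fin H(1)] assms(3) H(2) by simp
  \<comment> \<open>Here the bare cycle is excluded: it has an odd number of vertices but value
    0.\<close>
  have ne: "hair_type H \<noteq> {}"
  proof
    assume "hair_type H = {}"
    then have "ps = []" if "(A, ps) \<in> H" for A ps
      using that unfolding reduced_hair_type[OF red] by blast
    then have "attach_hairs ?C H = ?C"
      by (intro graph.expand) (fastforce simp: attach_hairs_def)
    then show False using assms(4) H(2) by simp
  qed
  have "nim_value G = 4" if even: "even (card (verts G))" and two: "two_consecutive_hairs G"
  proof -
    \<comment> \<open>The two hairs of the definition give a decomposition of their own. As the
      value can be computed from either one, it need not be compared with \<open>H\<close>.\<close>
    obtain H' where H': "hair_system ?C H'" "G = attach_hairs ?C H'" "consecutive (hair_type H')"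
      using two_consecutive_hairs_decomposition[OF two] by blast
    then show ?thesis using nim[OF H'(1,2)] parity[OF H'(1,2)] even by (simp add: type_value_odd)
  qed
  moreover have "nim_value G = 0" if "even (card (verts G))" "\<not> two_consecutive_hairs G"
    using nim[OF H] parity[OF H] that consecutive_two_consecutive_hairs[OF H red]
    by (auto simp: type_value_odd)
  moreover have "nim_value G = 3" if "odd (card (verts G))"
    using nim[OF H] parity[OF H] that ne by (simp add: type_value_even)
  ultimately show ?thesis by blast
qed

end
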